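(* Let $\mathcal{C}$ be an abelian category. The following conditions are equivalent: (a) the contravariant functor $\mathrm{Ext}^1_{\mathcal{C}}(-,M)$ is right exact for every object $M$ of $\mathcal{C}$; (b) the functor $\mathrm{Ext}^1_{\mathcal{C}}(M,-)$ is right exact for every object $M$ of $\mathcal{C}$; (c) $\mathcal{C}$ is hereditary, i.e. $\mathrm{Ext}^2_{\mathcal{C}}(X,Y)=0$ for all objects $X,Y$ of $\mathcal{C}$.
   Context: No existence of enough projectives or injectives is assumed. $\mathrm{Ext}^n$ denotes Yoneda Ext: for $n\ge1$, $\mathrm{Ext}^n_{\mathcal{C}}(X,Z)$ is the abelian group (under Baer sum) of equivalence classes of exact sequences $0\to Z\to B_1\to\cdots\to B_n\to X\to 0$ in $\mathcal{C}$, where equivalence is generated by morphisms of such sequences that are the identity on $Z$ and $X$. Right exactness of $\mathrm{Ext}^1_{\mathcal{C}}(M,-)$ (respectively of the contravariant functor $\mathrm{Ext}^1_{\mathcal{C}}(-,M)$) means that for every short exact sequence $0\to A\to B\to D\to 0$ in $\mathcal{C}$ the induced sequence $\mathrm{Ext}^1_{\mathcal{C}}(M,A)\to\mathrm{Ext}^1_{\mathcal{C}}(M,B)\to\mathrm{Ext}^1_{\mathcal{C}}(M,D)\to0$ (respectively $\mathrm{Ext}^1_{\mathcal{C}}(D,M)\to\mathrm{Ext}^1_{\mathcal{C}}(B,M)\to\mathrm{Ext}^1_{\mathcal{C}}(A,M)\to0$) is exact. *)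

theory Defs
  imports "HOL-Algebra.Coset"
begin

section \<open>Abelian categories\<close>

text \<open>
  A category is given by a set of objects and a set of arrows. The arrows between two fixed objects
  carry an addition (\<open>hadd\<close>, written \<open>\<boxplus>\<close>) with neutral element \<open>hzero X Y\<close>. Composition is
  written in the usual order: \<open>g \<cdot> f\<close> is \<open>f\<close> followed by \<open>g\<close>. The operations are only constrained
  on the sets \<open>Obj\<close> and \<open>Arr\<close>.
\<close>

record ('o, 'a) precat =
  Obj :: "'o set"
  Arr :: "'a set"
  Dom :: "'a \<Rightarrow> 'o"
  Cod :: "'a \<Rightarrow> 'o"
  idn :: "'o \<Rightarrow> 'a"
  compo :: "'a \<Rightarrow> 'a \<Rightarrow> 'a"  (infixl "\<cdot>\<index>" 70)
  hadd :: "'a \<Rightarrow> 'a \<Rightarrow> 'a"  (infixl "\<boxplus>\<index>" 65)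
  hzero :: "'o \<Rightarrow> 'o \<Rightarrow> 'a"

definition Hom :: "('o, 'a) precat \<Rightarrow> 'o \<Rightarrow> 'o \<Rightarrow> 'a set" where
  "Hom C X Y = {f \<in> Arr C. Dom C f = X \<and> Cod C f = Y}"

definition hom_group :: "('o, 'a) precat \<Rightarrow> 'o \<Rightarrow> 'o \<Rightarrow> 'a monoid" where
  "hom_group C X Y = \<lparr>carrier = Hom C X Y, mult = hadd C, one = hzero C X Y\<rparr>"

locale category =
  fixes C :: "('o, 'a) precat" (structure)
  assumes Dom_in: "f \<in> Arr C \<Longrightarrow> Dom C f \<in> Obj C"
    and Cod_in: "f \<in> Arr C \<Longrightarrow> Cod C f \<in> Obj C"
    and idn_in: "X \<in> Obj C \<Longrightarrow> idn C X \<in> Hom C X X"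
    and compo_in: "\<lbrakk>f \<in> Hom C X Y; g \<in> Hom C Y Z\<rbrakk> \<Longrightarrow> g \<cdot> f \<in> Hom C X Z"
    and idn_right: "f \<in> Hom C X Y \<Longrightarrow> f \<cdot> idn C X = f"
    and idn_left: "f \<in> Hom C X Y \<Longrightarrow> idn C Y \<cdot> f = f"
    and compo_assoc:
      "\<lbrakk>f \<in> Hom C W X; g \<in> Hom C X Y; h \<in> Hom C Y Z\<rbrakk> \<Longrightarrow> (h \<cdot> g) \<cdot> f = h \<cdot> (g \<cdot> f)"

locale preadditive_category = category +
  assumes hom_comm_group: "\<lbrakk>X \<in> Obj C; Y \<in> Obj C\<rbrakk> \<Longrightarrow> comm_group (hom_group C X Y)"
    and compo_hadd_right:
      "\<lbrakk>f \<in> Hom C X Y; f' \<in> Hom C X Y; g \<in> Hom C Y Z\<rbrakk> \<Longrightarrow> g \<cdot> (f \<boxplus> f') = (g \<cdot> f) \<boxplus> (g \<cdot> f')"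
    and compo_hadd_left:
      "\<lbrakk>f \<in> Hom C X Y; g \<in> Hom C Y Z; g' \<in> Hom C Y Z\<rbrakk> \<Longrightarrow> (g \<boxplus> g') \<cdot> f = (g \<cdot> f) \<boxplus> (g' \<cdot> f)"

definition is_zero_object :: "('o, 'a) precat \<Rightarrow> 'o \<Rightarrow> bool" where
  "is_zero_object C N \<longleftrightarrow>
     N \<in> Obj C \<and> (\<forall>X\<in>Obj C. (\<exists>!f. f \<in> Hom C N X) \<and> (\<exists>!f. f \<in> Hom C X N))"

definition is_biproduct ::
  "('o, 'a) precat \<Rightarrow> 'o \<Rightarrow> 'o \<Rightarrow> 'a \<Rightarrow> 'a \<Rightarrow> 'a \<Rightarrow> 'a \<Rightarrow> bool" where
  "is_biproduct C X Y i1 i2 p1 p2 \<longleftrightarrow>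
     (\<exists>S\<in>Obj C. i1 \<in> Hom C X S \<and> i2 \<in> Hom C Y S \<and> p1 \<in> Hom C S X \<and> p2 \<in> Hom C S Y \<and>
        p1 \<cdot>\<^bsub>C\<^esub> i1 = idn C X \<and> p2 \<cdot>\<^bsub>C\<^esub> i2 = idn C Y \<and>
        p2 \<cdot>\<^bsub>C\<^esub> i1 = hzero C X Y \<and> p1 \<cdot>\<^bsub>C\<^esub> i2 = hzero C Y X \<and>
        (i1 \<cdot>\<^bsub>C\<^esub> p1) \<boxplus>\<^bsub>C\<^esub> (i2 \<cdot>\<^bsub>C\<^esub> p2) = idn C S)"

definition monic :: "('o, 'a) precat \<Rightarrow> 'a \<Rightarrow> bool" where
  "monic C f \<longleftrightarrow> f \<in> Arr C \<and>
     (\<forall>W\<in>Obj C. \<forall>u\<in>Hom C W (Dom C f). \<forall>v\<in>Hom C W (Dom C f). f \<cdot>\<^bsub>C\<^esub> u = f \<cdot>\<^bsub>C\<^esub> v \<longrightarrow> u = v)"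

definition epic :: "('o, 'a) precat \<Rightarrow> 'a \<Rightarrow> bool" where
  "epic C f \<longleftrightarrow> f \<in> Arr C \<and>
     (\<forall>W\<in>Obj C. \<forall>u\<in>Hom C (Cod C f) W. \<forall>v\<in>Hom C (Cod C f) W. u \<cdot>\<^bsub>C\<^esub> f = v \<cdot>\<^bsub>C\<^esub> f \<longrightarrow> u = v)"

definition is_kernel :: "('o, 'a) precat \<Rightarrow> 'a \<Rightarrow> 'a \<Rightarrow> bool" where
  "is_kernel C f k \<longleftrightarrow>
     f \<in> Arr C \<and> k \<in> Arr C \<and> Cod C k = Dom C f \<and> f \<cdot>\<^bsub>C\<^esub> k = hzero C (Dom C k) (Cod C f) \<and>
     (\<forall>W\<in>Obj C. \<forall>h\<in>Hom C W (Dom C f). f \<cdot>\<^bsub>C\<^esub> h = hzero C W (Cod C f) \<longrightarrow>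
        (\<exists>!u. u \<in> Hom C W (Dom C k) \<and> k \<cdot>\<^bsub>C\<^esub> u = h))"

definition is_cokernel :: "('o, 'a) precat \<Rightarrow> 'a \<Rightarrow> 'a \<Rightarrow> bool" where
  "is_cokernel C f c \<longleftrightarrow>
     f \<in> Arr C \<and> c \<in> Arr C \<and> Dom C c = Cod C f \<and> c \<cdot>\<^bsub>C\<^esub> f = hzero C (Dom C f) (Cod C c) \<and>
     (\<forall>W\<in>Obj C. \<forall>h\<in>Hom C (Cod C f) W. h \<cdot>\<^bsub>C\<^esub> f = hzero C (Dom C f) W \<longrightarrow>
        (\<exists>!u. u \<in> Hom C (Cod C c) W \<and> u \<cdot>\<^bsub>C\<^esub> c = h))"

locale abelian_category = preadditive_category +
  assumes ex_zero_object: "\<exists>N. is_zero_object C N"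
    and ex_biproduct:
      "\<lbrakk>X \<in> Obj C; Y \<in> Obj C\<rbrakk> \<Longrightarrow> \<exists>i1 i2 p1 p2. is_biproduct C X Y i1 i2 p1 p2"
    and ex_kernel: "f \<in> Arr C \<Longrightarrow> \<exists>k. is_kernel C f k"
    and ex_cokernel: "f \<in> Arr C \<Longrightarrow> \<exists>c. is_cokernel C f c"
    and monic_is_kernel: "monic C m \<Longrightarrow> \<exists>f. is_kernel C f m"
    and epic_is_cokernel: "epic C e \<Longrightarrow> \<exists>f. is_cokernel C f e"


section \<open>Exact sequences and the Yoneda Ext groups\<close>

definition is_image :: "('o, 'a) precat \<Rightarrow> 'a \<Rightarrow> 'a \<Rightarrow> bool" where
  "is_image C f m \<longleftrightarrow> (\<exists>c. is_cokernel C f c \<and> is_kernel C c m)"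

text \<open>Exactness at the middle object: the image of \<open>f\<close> and the kernel of \<open>g\<close> are the same subobject.\<close>

definition exact_at :: "('o, 'a) precat \<Rightarrow> 'a \<Rightarrow> 'a \<Rightarrow> bool" where
  "exact_at C f g \<longleftrightarrow>
     f \<in> Arr C \<and> g \<in> Arr C \<and> Cod C f = Dom C g \<and> (\<exists>k. is_kernel C g k \<and> is_image C f k)"

definition short_exact :: "('o, 'a) precat \<Rightarrow> 'a \<Rightarrow> 'a \<Rightarrow> bool" where
  "short_exact C f g \<longleftrightarrow> monic C f \<and> exact_at C f g \<and> epic C g"

text \<open>
  An exact sequence \<open>0 \<rightarrow> Z \<rightarrow> B\<^sub>1 \<rightarrow> \<dots> \<rightarrow> B\<^sub>n \<rightarrow> X \<rightarrow> 0\<close> is encoded as the list of its \<open>n + 1\<close> arrows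
  between \<open>Z\<close> and \<open>X\<close>; the objects \<open>B\<^sub>i\<close> are determined by these. The definitions below are meant
  for \<open>n \<ge> 1\<close>; in particular \<open>Ext\<close> at \<open>n = 0\<close> is not intended to be the Hom group.
\<close>

definition n_extensions :: "('o, 'a) precat \<Rightarrow> nat \<Rightarrow> 'o \<Rightarrow> 'o \<Rightarrow> 'a list set" where
  "n_extensions C n X Z =
     {E. length E = n + 1 \<and> set E \<subseteq> Arr C \<and> Dom C (hd E) = Z \<and> Cod C (last E) = X \<and>
         monic C (hd E) \<and> epic C (last E) \<and> (\<forall>i<n. exact_at C (E ! i) (E ! Suc i))}"

text \<open>
  \<open>ext_morphism C a c E E'\<close>: there is a morphism of exact sequences from \<open>E\<close> to \<open>E'\<close> whose component
  at the left end is \<open>a\<close> and whose component at the right end is \<open>c\<close>.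
\<close>

definition ext_morphism :: "('o, 'a) precat \<Rightarrow> 'a \<Rightarrow> 'a \<Rightarrow> 'a list \<Rightarrow> 'a list \<Rightarrow> bool" where
  "ext_morphism C a c E E' \<longleftrightarrow>
     length E = length E' \<and>
     (\<exists>hs. length hs = length E + 1 \<and> hd hs = a \<and> last hs = c \<and>
        (\<forall>i<length E.
           hs ! i \<in> Hom C (Dom C (E ! i)) (Dom C (E' ! i)) \<and>
           hs ! Suc i \<in> Hom C (Cod C (E ! i)) (Cod C (E' ! i)) \<and>
           (E' ! i) \<cdot>\<^bsub>C\<^esub> (hs ! i) = (hs ! Suc i) \<cdot>\<^bsub>C\<^esub> (E ! i)))"

definition ext_step :: "('o, 'a) precat \<Rightarrow> nat \<Rightarrow> 'o \<Rightarrow> 'o \<Rightarrow> ('a list \<times> 'a list) set" where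
  "ext_step C n X Z =
     {(E, E'). E \<in> n_extensions C n X Z \<and> E' \<in> n_extensions C n X Z \<and>
               ext_morphism C (idn C Z) (idn C X) E E'}"

definition ext_equiv :: "('o, 'a) precat \<Rightarrow> nat \<Rightarrow> 'o \<Rightarrow> 'o \<Rightarrow> ('a list \<times> 'a list) set" where
  "ext_equiv C n X Z =
     (ext_step C n X Z \<union> (ext_step C n X Z)\<inverse>)\<^sup>* \<inter> n_extensions C n X Z \<times> n_extensions C n X Z"

text \<open>
  Functoriality. For \<open>a : Z \<rightarrow> Z'\<close>, the class \<open>a\<^sub>* \<xi>\<close> is the class of any extension \<open>E'\<close> of \<open>X\<close> by
  \<open>Z'\<close> that receives a morphism \<open>(a, \<dots>, id)\<close> from a representative of \<open>\<xi>\<close>: such \<open>E'\<close> exist (push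
  out along \<open>a\<close>) and by the universal property of the pushout they are all equivalent, so the set
  below is a single class. Dually for \<open>c : X' \<rightarrow> X\<close> and \<open>c\<^sup>* \<xi>\<close>, using pullbacks.
\<close>

definition ext_push :: "('o, 'a) precat \<Rightarrow> nat \<Rightarrow> 'o \<Rightarrow> 'a \<Rightarrow> 'a list set \<Rightarrow> 'a list set" where
  "ext_push C n X a \<xi> =
     ext_equiv C n X (Cod C a) ``
       {E' \<in> n_extensions C n X (Cod C a). \<exists>E\<in>\<xi>. ext_morphism C a (idn C X) E E'}"

definition ext_pull :: "('o, 'a) precat \<Rightarrow> nat \<Rightarrow> 'o \<Rightarrow> 'a \<Rightarrow> 'a list set \<Rightarrow> 'a list set" where
  "ext_pull C n Z c \<xi> =
     ext_equiv C n (Dom C c) Z ``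
       {E' \<in> n_extensions C n (Dom C c) Z. \<exists>E\<in>\<xi>. ext_morphism C (idn C Z) c E' E}"

text \<open>Chosen zero object and chosen biproducts, used for the Baer sum and the zero class.\<close>

definition zobj :: "('o, 'a) precat \<Rightarrow> 'o" where
  "zobj C = (SOME N. is_zero_object C N)"

definition biprod :: "('o, 'a) precat \<Rightarrow> 'o \<Rightarrow> 'o \<Rightarrow> 'a \<times> 'a \<times> 'a \<times> 'a" where
  "biprod C X Y = (SOME (i1, i2, p1, p2). is_biproduct C X Y i1 i2 p1 p2)"

definition in1 :: "('o, 'a) precat \<Rightarrow> 'o \<Rightarrow> 'o \<Rightarrow> 'a" where
  "in1 C X Y = (case biprod C X Y of (i1, i2, p1, p2) \<Rightarrow> i1)"

definition in2 :: "('o, 'a) precat \<Rightarrow> 'o \<Rightarrow> 'o \<Rightarrow> 'a" where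
  "in2 C X Y = (case biprod C X Y of (i1, i2, p1, p2) \<Rightarrow> i2)"

definition pr1 :: "('o, 'a) precat \<Rightarrow> 'o \<Rightarrow> 'o \<Rightarrow> 'a" where
  "pr1 C X Y = (case biprod C X Y of (i1, i2, p1, p2) \<Rightarrow> p1)"

definition pr2 :: "('o, 'a) precat \<Rightarrow> 'o \<Rightarrow> 'o \<Rightarrow> 'a" where
  "pr2 C X Y = (case biprod C X Y of (i1, i2, p1, p2) \<Rightarrow> p2)"

definition dsum_obj :: "('o, 'a) precat \<Rightarrow> 'o \<Rightarrow> 'o \<Rightarrow> 'o" where
  "dsum_obj C X Y = Cod C (in1 C X Y)"

definition dsum_arr :: "('o, 'a) precat \<Rightarrow> 'a \<Rightarrow> 'a \<Rightarrow> 'a" where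
  "dsum_arr C f g =
     (in1 C (Cod C f) (Cod C g) \<cdot>\<^bsub>C\<^esub> (f \<cdot>\<^bsub>C\<^esub> pr1 C (Dom C f) (Dom C g))) \<boxplus>\<^bsub>C\<^esub>
     (in2 C (Cod C f) (Cod C g) \<cdot>\<^bsub>C\<^esub> (g \<cdot>\<^bsub>C\<^esub> pr2 C (Dom C f) (Dom C g)))"

definition diag :: "('o, 'a) precat \<Rightarrow> 'o \<Rightarrow> 'a" where
  "diag C X = in1 C X X \<boxplus>\<^bsub>C\<^esub> in2 C X X"

definition codiag :: "('o, 'a) precat \<Rightarrow> 'o \<Rightarrow> 'a" where
  "codiag C X = pr1 C X X \<boxplus>\<^bsub>C\<^esub> pr2 C X X"

text \<open>
  The Baer sum of the classes of \<open>E\<close> and \<open>E'\<close> is obtained from \<open>E \<oplus> E'\<close> by pushing out along the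
  codiagonal of \<open>Z\<close> and pulling back along the diagonal of \<open>X\<close>.
\<close>

definition baer_sum ::
  "('o, 'a) precat \<Rightarrow> nat \<Rightarrow> 'o \<Rightarrow> 'o \<Rightarrow> 'a list set \<Rightarrow> 'a list set \<Rightarrow> 'a list set" where
  "baer_sum C n X Z \<xi> \<eta> =
     ext_pull C n Z (diag C X)
       (ext_push C n (dsum_obj C X X) (codiag C Z)
         (ext_equiv C n (dsum_obj C X X) (dsum_obj C Z Z) ``
           {map2 (dsum_arr C) E E' | E E'. E \<in> \<xi> \<and> E' \<in> \<eta>}))"

text \<open>
  The zero class is that of the split sequence \<open>0 \<rightarrow> Z \<rightarrow> Z \<oplus> X \<rightarrow> X \<rightarrow> 0\<close> for \<open>n = 1\<close>, and that of
  \<open>0 \<rightarrow> Z = Z \<rightarrow> 0 \<rightarrow> \<dots> \<rightarrow> 0 \<rightarrow> X = X \<rightarrow> 0\<close> for \<open>n \<ge> 2\<close>.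
\<close>

definition zero_extension :: "('o, 'a) precat \<Rightarrow> nat \<Rightarrow> 'o \<Rightarrow> 'o \<Rightarrow> 'a list" where
  "zero_extension C n X Z =
     (if n = 1 then [in1 C Z X, pr2 C Z X]
      else let Bs = [Z] @ replicate (n - 2) (zobj C) @ [X]
           in [idn C Z] @ map2 (hzero C) Bs (tl Bs) @ [idn C X])"

definition Ext :: "('o, 'a) precat \<Rightarrow> nat \<Rightarrow> 'o \<Rightarrow> 'o \<Rightarrow> 'a list set monoid" where
  "Ext C n X Z =
     \<lparr>carrier = n_extensions C n X Z // ext_equiv C n X Z,
      mult = baer_sum C n X Z,
      one = ext_equiv C n X Z `` {zero_extension C n X Z}\<rparr>"


section \<open>Right exactness and hereditary categories\<close>

text \<open>
  Exactness of a sequence of groups \<open>G \<rightarrow> H \<rightarrow> K \<rightarrow> 0\<close>.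
\<close>

definition right_exact_seq ::
  "'g monoid \<Rightarrow> ('g \<Rightarrow> 'h) \<Rightarrow> 'h monoid \<Rightarrow> ('h \<Rightarrow> 'k) \<Rightarrow> 'k monoid \<Rightarrow> bool" where
  "right_exact_seq G \<phi> H \<psi> K \<longleftrightarrow>
     \<phi> ` carrier G = kernel H K \<psi> \<and> \<psi> ` carrier H = carrier K"

definition Ext1_covariant_right_exact :: "('o, 'a) precat \<Rightarrow> 'o \<Rightarrow> bool" where
  "Ext1_covariant_right_exact C M \<longleftrightarrow>
     (\<forall>f g. short_exact C f g \<longrightarrow>
        right_exact_seq
          (Ext C 1 M (Dom C f)) (ext_push C 1 M f)
          (Ext C 1 M (Dom C g)) (ext_push C 1 M g)
          (Ext C 1 M (Cod C g)))"

definition Ext1_contravariant_right_exact :: "('o, 'a) precat \<Rightarrow> 'o \<Rightarrow> bool" where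
  "Ext1_contravariant_right_exact C M \<longleftrightarrow>
     (\<forall>f g. short_exact C f g \<longrightarrow>
        right_exact_seq
          (Ext C 1 (Cod C g) M) (ext_pull C 1 M g)
          (Ext C 1 (Dom C g) M) (ext_pull C 1 M f)
          (Ext C 1 (Dom C f) M))"

definition hereditary :: "('o, 'a) precat \<Rightarrow> bool" where
  "hereditary C \<longleftrightarrow>
     (\<forall>X\<in>Obj C. \<forall>Y\<in>Obj C. carrier (Ext C 2 X Y) = {\<one>\<^bsub>Ext C 2 X Y\<^esub>})"

end

theory Submission
  imports Defs
begin

text \<open>
  The sequence \<open>Ext\<^sup>1(M, A) \<rightarrow> Ext\<^sup>1(M, B) \<rightarrow> Ext\<^sup>1(M, D)\<close> is always exact in the middle, so right
  exactness means that every extension of \<open>M\<close> by \<open>D\<close> is a pushout along the given epimorphism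
  \<open>g : B \<rightarrow> D\<close>. For an extension \<open>D \<rightarrow> P \<rightarrow> M\<close> with arrows \<open>h\<close> and \<open>p\<close>, this asks for a factorization
  \<open>e \<cdot> j = h \<cdot> g\<close> through an object \<open>E\<close> such that \<open>0 \<rightarrow> B \<rightarrow> E \<rightarrow> M \<rightarrow> 0\<close>, with arrows \<open>j\<close> and
  \<open>p \<cdot> e\<close>, is exact. If \<open>u\<close> is the kernel of \<open>g\<close>, it is equivalent that \<open>j \<cdot> u\<close> and \<open>e\<close> form a short
  exact sequence, so the condition is self-dual, which relates (a) and (b). The existence of such a
  factorization is invariant under morphisms of \<open>2\<close>-extensions and holds for the zero extension;
  conversely, it links the splice \<open>0 \<rightarrow> A \<rightarrow> B \<rightarrow> P \<rightarrow> M \<rightarrow> 0\<close> to the zero extension through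
  \<open>0 \<rightarrow> A \<rightarrow> A \<oplus> B \<rightarrow> E \<rightarrow> M \<rightarrow> 0\<close>. This relates (b) and (c).
\<close>

section \<open>Arrows in abelian categories\<close>

context category
begin

lemma compo_type [simp]:
  assumes "f \<in> Arr C" "g \<in> Arr C" "Cod C f = Dom C g"
  shows "g \<cdot> f \<in> Arr C" "Dom C (g \<cdot> f) = Dom C f" "Cod C (g \<cdot> f) = Cod C g"
  using compo_in[of f "Dom C f" "Dom C g" g "Cod C g"] assms by (auto simp: Hom_def)

lemma assoc [simp]:
  assumes "f \<in> Arr C" "g \<in> Arr C" "h \<in> Arr C" "Cod C f = Dom C g" "Cod C g = Dom C h"
  shows "(h \<cdot> g) \<cdot> f = h \<cdot> (g \<cdot> f)"
  using compo_assoc[of f "Dom C f" "Dom C g" g "Dom C h" h "Cod C h"] assms by (auto simp: Hom_def)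

lemma idn_type [simp]:
  assumes "X \<in> Obj C"
  shows "idn C X \<in> Arr C" "Dom C (idn C X) = X" "Cod C (idn C X) = X"
  using idn_in[OF assms] by (auto simp: Hom_def)

lemma Dom_Cod_Obj [simp]:
  assumes "f \<in> Arr C"
  shows "Dom C f \<in> Obj C" "Cod C f \<in> Obj C"
  using assms Dom_in Cod_in by auto

text \<open>Beyond unfolding, this provides the memberships in \<open>Obj C\<close> on which most of
  the simplification rules below are conditioned.\<close>

lemma Hom_iff:
  "f \<in> Hom C X Y \<longleftrightarrow> f \<in> Arr C \<and> Dom C f = X \<and> Cod C f = Y \<and> X \<in> Obj C \<and> Y \<in> Obj C"
  using Dom_in Cod_in by (auto simp: Hom_def)

lemma Hom_Obj:
  assumes "f \<in> Hom C X Y"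
  shows "X \<in> Obj C" "Y \<in> Obj C"
  using assms by (simp_all add: Hom_iff)

lemma compo_idn [simp]:
  assumes "f \<in> Arr C"
  shows "Dom C f = X \<Longrightarrow> f \<cdot> idn C X = f" "Cod C f = X \<Longrightarrow> idn C X \<cdot> f = f"
  using assms idn_right idn_left by (auto simp: Hom_iff)

text \<open>Composites are normalized to right-nested form by \<open>assoc\<close>, where
  \<open>g \<cdot> f\<close> is no longer a subterm of \<open>g \<cdot> (f \<cdot> x)\<close>; this
  is the form in which an equation for \<open>g \<cdot> f\<close> can still be used for
  rewriting.\<close>

lemma reassoc:
  assumes "g \<cdot> f = d" "f \<in> Arr C" "g \<in> Arr C" "Cod C f = Dom C g" "x \<in> Arr C" "Cod C x = Dom C f"
  shows "g \<cdot> (f \<cdot> x) = d \<cdot> x"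
  unfolding assms(1)[symmetric] using assms(2-) by simp

lemma monicD:
  assumes "monic C f" "f \<in> Hom C A B" "u \<in> Hom C W A" "v \<in> Hom C W A" "f \<cdot> u = f \<cdot> v"
  shows "u = v"
proof -
  have "W \<in> Obj C" "Dom C f = A" using assms(2,3) by (auto simp: Hom_iff)
  then show ?thesis using assms unfolding monic_def by blast
qed

lemma epicD:
  assumes "epic C f" "f \<in> Hom C A B" "u \<in> Hom C B W" "v \<in> Hom C B W" "u \<cdot> f = v \<cdot> f"
  shows "u = v"
proof -
  have "W \<in> Obj C" "Cod C f = B" using assms(2,3) by (auto simp: Hom_iff)
  then show ?thesis using assms unfolding epic_def by blast
qed

end

section \<open>Zero arrows, subtraction, and the mapping properties of kernels and cokernels\<close>

context preadditive_category
begin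

lemma hzero_type [simp]:
  assumes "X \<in> Obj C" "Y \<in> Obj C"
  shows "hzero C X Y \<in> Arr C" "Dom C (hzero C X Y) = X" "Cod C (hzero C X Y) = Y"
proof -
  interpret G: comm_group "hom_group C X Y" using hom_comm_group assms .
  have "hzero C X Y \<in> Hom C X Y" using G.one_closed by (simp add: hom_group_def)
  then show "hzero C X Y \<in> Arr C" "Dom C (hzero C X Y) = X" "Cod C (hzero C X Y) = Y"
    by (auto simp: Hom_iff)
qed

lemma hadd_type [simp]:
  assumes "f \<in> Arr C" "g \<in> Arr C" "Dom C f = Dom C g" "Cod C f = Cod C g"
  shows "f \<boxplus> g \<in> Arr C" "Dom C (f \<boxplus> g) = Dom C g" "Cod C (f \<boxplus> g) = Cod C g"
proof -
  interpret G: comm_group "hom_group C (Dom C g) (Cod C g)" using hom_comm_group assms by simp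
  have "f \<boxplus> g \<in> Hom C (Dom C g) (Cod C g)"
    using G.m_closed[of f g] assms by (simp add: hom_group_def Hom_def)
  then show "f \<boxplus> g \<in> Arr C" "Dom C (f \<boxplus> g) = Dom C g" "Cod C (f \<boxplus> g) = Cod C g"
    by (auto simp: Hom_iff)
qed

lemma hadd_hzero [simp]:
  assumes "f \<in> Arr C" "Dom C f = X" "Cod C f = Y"
  shows "f \<boxplus> hzero C X Y = f" "hzero C X Y \<boxplus> f = f"
proof -
  interpret G: comm_group "hom_group C X Y" using hom_comm_group assms by auto
  show "f \<boxplus> hzero C X Y = f" "hzero C X Y \<boxplus> f = f"
    using G.r_one[of f] G.l_one[of f] assms by (simp_all add: hom_group_def Hom_def)
qed

lemma hadd_right_cancel:
  assumes "f \<in> Hom C X Y" "g \<in> Hom C X Y" "h \<in> Hom C X Y" "f \<boxplus> h = g \<boxplus> h"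
  shows "f = g"
proof -
  interpret G: comm_group "hom_group C X Y" using hom_comm_group assms(1) Hom_Obj by auto
  show ?thesis using G.right_cancel[of h f g] assms by (simp add: hom_group_def)
qed

lemma ex_negative:
  assumes "f \<in> Hom C X Y"
  shows "\<exists>f'\<in>Hom C X Y. f \<boxplus> f' = hzero C X Y"
proof -
  interpret G: comm_group "hom_group C X Y" using hom_comm_group assms Hom_Obj by auto
  show ?thesis using G.r_inv_ex[of f] assms by (auto simp: hom_group_def)
qed

lemma compo_distrib [simp]:
  assumes "f \<in> Arr C" "f' \<in> Arr C" "Dom C f = Dom C f'" "Cod C f = Cod C f'" "g \<in> Arr C"
  shows "Cod C f' = Dom C g \<Longrightarrow> g \<cdot> (f \<boxplus> f') = (g \<cdot> f) \<boxplus> (g \<cdot> f')"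
    and "Cod C g = Dom C f' \<Longrightarrow> (f \<boxplus> f') \<cdot> g = (f \<cdot> g) \<boxplus> (f' \<cdot> g)"
  using assms compo_hadd_right[of f "Dom C f'" "Dom C g" f' g "Cod C g"]
    compo_hadd_left[of g "Dom C g" "Cod C g" f "Cod C f'" f']
  by (auto simp: Hom_iff)

lemma compo_hzero [simp]:
  assumes "f \<in> Arr C" "W \<in> Obj C"
  shows "Dom C f = X \<Longrightarrow> f \<cdot> hzero C W X = hzero C W (Cod C f)"
    and "Cod C f = X \<Longrightarrow> hzero C X W \<cdot> f = hzero C (Dom C f) W"
proof -
  assume [simp]: "Dom C f = X"
  have [simp]: "X \<in> Obj C" using assms Dom_in[of f] by simp
  let ?z = "hzero C W X"
  \<comment> \<open>As in a ring, \<open>f\<close> is distributed over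
    \<open>?z \<boxplus> ?z\<close>, the sum is collapsed in the next line, and one summand is
    cancelled. The rule for adding zero is removed so that the sum survives until then.\<close>
  have "f \<cdot> ?z \<boxplus> f \<cdot> ?z = f \<cdot> (?z \<boxplus> ?z)" using assms by (simp del: hadd_hzero)
  also have "\<dots> = hzero C W (Cod C f) \<boxplus> f \<cdot> ?z" using assms by simp
  finally show "f \<cdot> hzero C W X = hzero C W (Cod C f)"
    using assms by (intro hadd_right_cancel[of "f \<cdot> ?z" W "Cod C f" _ "f \<cdot> ?z"]) (auto simp: Hom_iff)
next
  assume [simp]: "Cod C f = X"
  have [simp]: "X \<in> Obj C" using assms Cod_in[of f] by simp
  let ?z = "hzero C X W"
  have "?z \<cdot> f \<boxplus> ?z \<cdot> f = (?z \<boxplus> ?z) \<cdot> f" using assms by (simp del: hadd_hzero)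
  also have "\<dots> = hzero C (Dom C f) W \<boxplus> ?z \<cdot> f" using assms by simp
  finally show "hzero C X W \<cdot> f = hzero C (Dom C f) W"
    using assms by (intro hadd_right_cancel[of "?z \<cdot> f" "Dom C f" W _ "?z \<cdot> f"]) (auto simp: Hom_iff)
qed

text \<open>Arrows \<open>u\<close> and \<open>v\<close> with the same composite have a difference
  that \<open>f\<close> sends to zero, so additivity reduces cancellation to arrows with zero
  composite.\<close>

lemma monicI:
  assumes f: "f \<in> Hom C A B"
    and z: "\<And>W u. u \<in> Hom C W A \<Longrightarrow> f \<cdot> u = hzero C W B \<Longrightarrow> u = hzero C W A"
  shows "monic C f"
  unfolding monic_def
proof (intro conjI ballI impI)
  show "f \<in> Arr C" using f by (simp add: Hom_iff)
next
  fix W u v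
  assume W: "W \<in> Obj C" and "u \<in> Hom C W (Dom C f)" "v \<in> Hom C W (Dom C f)" and e: "f \<cdot> u = f \<cdot> v"
  then have u: "u \<in> Hom C W A" and v: "v \<in> Hom C W A" using f by (auto simp: Hom_iff)
  obtain v' where v': "v' \<in> Hom C W A" "v \<boxplus> v' = hzero C W A" using ex_negative[OF v] by auto
  have "f \<cdot> (u \<boxplus> v') = f \<cdot> (v \<boxplus> v')" using f u v v'(1) e by (simp add: Hom_iff)
  also have "\<dots> = hzero C W B" using v'(2) f W by (auto simp: Hom_iff)
  finally have "u \<boxplus> v' = v \<boxplus> v'" using z[of "u \<boxplus> v'" W] u v' by (auto simp: Hom_iff)
  then show "u = v" using hadd_right_cancel u v v'(1) by blast
qed

lemma epicI:
  assumes f: "f \<in> Hom C A B"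
    and z: "\<And>W u. u \<in> Hom C B W \<Longrightarrow> u \<cdot> f = hzero C A W \<Longrightarrow> u = hzero C B W"
  shows "epic C f"
  unfolding epic_def
proof (intro conjI ballI impI)
  show "f \<in> Arr C" using f by (simp add: Hom_iff)
next
  fix W u v
  assume W: "W \<in> Obj C" and "u \<in> Hom C (Cod C f) W" "v \<in> Hom C (Cod C f) W" and e: "u \<cdot> f = v \<cdot> f"
  then have u: "u \<in> Hom C B W" and v: "v \<in> Hom C B W" using f by (auto simp: Hom_iff)
  obtain v' where v': "v' \<in> Hom C B W" "v \<boxplus> v' = hzero C B W" using ex_negative[OF v] by auto
  have "(u \<boxplus> v') \<cdot> f = (v \<boxplus> v') \<cdot> f" using f u v v'(1) e by (simp add: Hom_iff)
  also have "\<dots> = hzero C A W" using v'(2) f W by (auto simp: Hom_iff)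
  finally have "u \<boxplus> v' = v \<boxplus> v'" using z[of "u \<boxplus> v'" W] u v' by (auto simp: Hom_iff)
  then show "u = v" using hadd_right_cancel u v v'(1) by blast
qed

lemma monic_zeroD:
  assumes "monic C f" "f \<in> Hom C A B" "u \<in> Hom C W A" "f \<cdot> u = hzero C W B"
  shows "u = hzero C W A"
  by (rule monicD[OF assms(1,2,3)]) (use assms in \<open>auto simp: Hom_iff\<close>)

lemma epic_zeroD:
  assumes "epic C f" "f \<in> Hom C A B" "u \<in> Hom C B W" "u \<cdot> f = hzero C A W"
  shows "u = hzero C B W"
  by (rule epicD[OF assms(1,2,3)]) (use assms in \<open>auto simp: Hom_iff\<close>)

lemma kernel_factor:
  assumes "is_kernel C g f" "f \<in> Hom C A B" "g \<in> Hom C B D" "h \<in> Hom C W B" "g \<cdot> h = hzero C W D"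
  shows "\<exists>u\<in>Hom C W A. f \<cdot> u = h"
proof -
  have "W \<in> Obj C" "h \<in> Hom C W (Dom C g)" "g \<cdot> h = hzero C W (Cod C g)" "Dom C f = A"
    using assms by (auto simp: Hom_iff)
  then show ?thesis using assms(1) unfolding is_kernel_def by metis
qed

lemma cokernel_factor:
  assumes "is_cokernel C f g" "f \<in> Hom C A B" "g \<in> Hom C B D" "h \<in> Hom C B W" "h \<cdot> f = hzero C A W"
  shows "\<exists>u\<in>Hom C D W. u \<cdot> g = h"
proof -
  have "W \<in> Obj C" "h \<in> Hom C (Cod C f) W" "h \<cdot> f = hzero C (Dom C f) W" "Cod C g = D"
    using assms by (auto simp: Hom_iff)
  then show ?thesis using assms(1) unfolding is_cokernel_def by metis
qed

lemma kernel_zero: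
  assumes "is_kernel C g f" "f \<in> Hom C A B" "g \<in> Hom C B D"
  shows "g \<cdot> f = hzero C A D"
  using assms unfolding is_kernel_def by (auto simp: Hom_iff)

lemma cokernel_zero:
  assumes "is_cokernel C f g" "f \<in> Hom C A B" "g \<in> Hom C B D"
  shows "g \<cdot> f = hzero C A D"
  using assms unfolding is_cokernel_def by (auto simp: Hom_iff)

lemma kernel_monic:
  assumes "is_kernel C g f" "f \<in> Hom C A B" "g \<in> Hom C B D"
  shows "monic C f"
  unfolding monic_def
proof (intro conjI ballI impI)
  show "f \<in> Arr C" using assms by (simp add: Hom_iff)
next
  fix W u v
  assume W: "W \<in> Obj C" and u: "u \<in> Hom C W (Dom C f)" and v: "v \<in> Hom C W (Dom C f)"
    and e: "f \<cdot> u = f \<cdot> v"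
  have "g \<cdot> (f \<cdot> u) = hzero C W D"
    using assms u W by (simp add: reassoc[OF kernel_zero[OF assms]] Hom_iff)
  moreover have "f \<cdot> u \<in> Hom C W (Dom C g)" using assms u by (auto simp: Hom_iff)
  moreover have "Cod C g = D" using assms by (simp add: Hom_iff)
  ultimately show "u = v" using assms(1) W u v e unfolding is_kernel_def by metis
qed

lemma cokernel_epic:
  assumes "is_cokernel C f g" "f \<in> Hom C A B" "g \<in> Hom C B D"
  shows "epic C g"
  unfolding epic_def
proof (intro conjI ballI impI)
  show "g \<in> Arr C" using assms by (simp add: Hom_iff)
next
  fix W u v
  assume W: "W \<in> Obj C" and u: "u \<in> Hom C (Cod C g) W" and v: "v \<in> Hom C (Cod C g) W"
    and e: "u \<cdot> g = v \<cdot> g"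
  have "(u \<cdot> g) \<cdot> f = hzero C A W"
    using assms u W by (simp add: cokernel_zero[OF assms] Hom_iff)
  moreover have "u \<cdot> g \<in> Hom C (Cod C f) W" using assms u by (auto simp: Hom_iff)
  moreover have "Dom C f = A" using assms by (simp add: Hom_iff)
  ultimately show "u = v" using assms(1) W u v e unfolding is_cokernel_def by metis
qed

lemma kernelI:
  assumes f: "f \<in> Hom C A B" and g: "g \<in> Hom C B D" and "g \<cdot> f = hzero C A D" and m: "monic C f"
    and ex: "\<And>W h. h \<in> Hom C W B \<Longrightarrow> g \<cdot> h = hzero C W D \<Longrightarrow> \<exists>u\<in>Hom C W A. f \<cdot> u = h"
  shows "is_kernel C g f"
  unfolding is_kernel_def
proof (intro conjI ballI impI)
  fix W h assume "W \<in> Obj C" "h \<in> Hom C W (Dom C g)" "g \<cdot> h = hzero C W (Cod C g)"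
  then have "h \<in> Hom C W B" "g \<cdot> h = hzero C W D" using g by (auto simp: Hom_iff)
  then obtain u where "u \<in> Hom C W A" "f \<cdot> u = h" using ex by blast
  moreover have "Dom C f = A" using f by (simp add: Hom_iff)
  ultimately show "\<exists>!u. u \<in> Hom C W (Dom C f) \<and> f \<cdot> u = h"
    using monicD[OF m f] by metis
qed (use assms in \<open>auto simp: Hom_iff\<close>)

lemma cokernelI:
  assumes f: "f \<in> Hom C A B" and g: "g \<in> Hom C B D" and "g \<cdot> f = hzero C A D" and m: "epic C g"
    and ex: "\<And>W h. h \<in> Hom C B W \<Longrightarrow> h \<cdot> f = hzero C A W \<Longrightarrow> \<exists>u\<in>Hom C D W. u \<cdot> g = h"
  shows "is_cokernel C f g"
  unfolding is_cokernel_def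
proof (intro conjI ballI impI)
  fix W h assume "W \<in> Obj C" "h \<in> Hom C (Cod C f) W" "h \<cdot> f = hzero C (Dom C f) W"
  then have "h \<in> Hom C B W" "h \<cdot> f = hzero C A W" using f by (auto simp: Hom_iff)
  then obtain u where "u \<in> Hom C D W" "u \<cdot> g = h" using ex by blast
  moreover have "Cod C g = D" using g by (simp add: Hom_iff)
  ultimately show "\<exists>!u. u \<in> Hom C (Cod C g) W \<and> u \<cdot> g = h"
    using epicD[OF m g] by metis
qed (use assms in \<open>auto simp: Hom_iff\<close>)

end

section \<open>The opposite category\<close>

text \<open>Objects and arrows are kept as they are, so a dual statement speaks of the same arrows
  and is obtained by applying a lemma to \<open>opp C\<close> and simplifying. The arguments of
  \<open>hzero\<close> are exchanged because they are a domain and a codomain.\<close>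

definition opp :: "('o, 'a) precat \<Rightarrow> ('o, 'a) precat" where
  "opp C = C\<lparr>Dom := Cod C, Cod := Dom C, compo := \<lambda>g f. f \<cdot>\<^bsub>C\<^esub> g, hzero := \<lambda>X Y. hzero C Y X\<rparr>"

lemma opp_simps [simp]:
  "Obj (opp C) = Obj C" "Arr (opp C) = Arr C" "Dom (opp C) = Cod C" "Cod (opp C) = Dom C"
  "idn (opp C) = idn C" "g \<cdot>\<^bsub>opp C\<^esub> f = f \<cdot>\<^bsub>C\<^esub> g" "hadd (opp C) = hadd C"
  "hzero (opp C) X Y = hzero C Y X"
  by (simp_all add: opp_def)

lemma Hom_opp [simp]: "Hom (opp C) X Y = Hom C Y X"
  by (auto simp: Hom_def)

lemma monic_opp [simp]: "monic (opp C) f \<longleftrightarrow> epic C f"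
  by (simp add: monic_def epic_def)

lemma epic_opp [simp]: "epic (opp C) f \<longleftrightarrow> monic C f"
  by (simp add: monic_def epic_def)

lemma is_kernel_opp [simp]: "is_kernel (opp C) f k \<longleftrightarrow> is_cokernel C f k"
  by (simp add: is_kernel_def is_cokernel_def)

lemma is_cokernel_opp [simp]: "is_cokernel (opp C) f k \<longleftrightarrow> is_kernel C f k"
  by (simp add: is_kernel_def is_cokernel_def)

lemma hom_group_opp [simp]: "hom_group (opp C) X Y = hom_group C Y X"
  by (simp add: hom_group_def)

lemma is_zero_object_opp [simp]: "is_zero_object (opp C) N \<longleftrightarrow> is_zero_object C N"
  by (auto simp: is_zero_object_def)

lemma is_biproduct_opp:
  "is_biproduct C X Y i1 i2 p1 p2 \<Longrightarrow> is_biproduct (opp C) X Y p1 p2 i1 i2"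
  by (auto simp: is_biproduct_def)

lemma abelian_category_opp:
  assumes "abelian_category C"
  shows "abelian_category (opp C)"
proof -
  interpret abelian_category C by fact
  show ?thesis
  proof (intro abelian_category.intro preadditive_category.intro category.intro
      preadditive_category_axioms.intro abelian_category_axioms.intro)
    fix f W X g Y h Z
    assume "f \<in> Hom (opp C) W X" "g \<in> Hom (opp C) X Y" "h \<in> Hom (opp C) Y Z"
    then show "h \<cdot>\<^bsub>opp C\<^esub> g \<cdot>\<^bsub>opp C\<^esub> f = h \<cdot>\<^bsub>opp C\<^esub> (g \<cdot>\<^bsub>opp C\<^esub> f)"
      by (simp add: Hom_iff)
  next
    fix X Y assume "X \<in> Obj (opp C)" "Y \<in> Obj (opp C)"
    then obtain i1 i2 p1 p2 where "is_biproduct C X Y i1 i2 p1 p2" using ex_biproduct[of X Y] by auto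
    then show "\<exists>i1 i2 p1 p2. is_biproduct (opp C) X Y i1 i2 p1 p2" by (intro exI) (rule is_biproduct_opp)
  next
    fix f X Y g Z assume "f \<in> Hom (opp C) X Y" "g \<in> Hom (opp C) Y Z"
    then show "g \<cdot>\<^bsub>opp C\<^esub> f \<in> Hom (opp C) X Z" by (simp add: Hom_iff)
  qed (auto simp: Hom_iff hom_comm_group ex_zero_object ex_kernel ex_cokernel monic_is_kernel epic_is_cokernel)
qed

section \<open>Short exact sequences\<close>

text \<open>The three objects are written out so that the types of both arrows are at hand.\<close>

definition ses :: "('o, 'a) precat \<Rightarrow> 'o \<Rightarrow> 'a \<Rightarrow> 'o \<Rightarrow> 'a \<Rightarrow> 'o \<Rightarrow> bool" where
  "ses C A f B g D \<longleftrightarrow> f \<in> Hom C A B \<and> g \<in> Hom C B D \<and> short_exact C f g"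

lemma short_exact_ses:
  assumes "short_exact C f g"
  shows "ses C (Dom C f) f (Dom C g) g (Cod C g)"
  using assms unfolding ses_def short_exact_def exact_at_def by (auto simp: Hom_def)

section \<open>Criteria for short exactness\<close>

context abelian_category
begin

lemma opp_abelian: "abelian_category (opp C)"
  using abelian_category_opp abelian_category_axioms .

text \<open>The monic \<open>f\<close> is the kernel of some \<open>r\<close>. Since
  \<open>r\<close> kills \<open>f\<close>, it factors through the cokernel \<open>g\<close>; so
  whatever \<open>g\<close> kills, \<open>r\<close> kills too, and it factors through
  \<open>f\<close>.\<close>

lemma monic_kernel_of_cokernel:
  assumes m: "monic C f" and c: "is_cokernel C f g" and f: "f \<in> Hom C A B" and g: "g \<in> Hom C B D"
  shows "is_kernel C g f"
proof (rule kernelI[OF f g cokernel_zero[OF c f g] m])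
  fix W h assume h: "h \<in> Hom C W B" "g \<cdot> h = hzero C W D"
  obtain r where r: "is_kernel C r f" using monic_is_kernel[OF m] by auto
  define R where "R = Cod C r"
  have r': "r \<in> Hom C B R" using r f unfolding is_kernel_def R_def by (auto simp: Hom_iff)
  obtain s where s: "s \<in> Hom C D R" "s \<cdot> g = r"
    using cokernel_factor[OF c f g r' kernel_zero[OF r f r']] by auto
  have "r \<cdot> h = s \<cdot> (g \<cdot> h)" using h(1) g s by (auto simp: Hom_iff)
  then have "r \<cdot> h = hzero C W R" using h s by (simp add: Hom_iff)
  then show "\<exists>u\<in>Hom C W A. f \<cdot> u = h" using kernel_factor[OF r f r' h(1)] by simp
qed

lemma epic_cokernel_of_kernel:
  assumes "epic C g" "is_kernel C g f" "f \<in> Hom C A B" "g \<in> Hom C B D"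
  shows "is_cokernel C f g"
  using abelian_category.monic_kernel_of_cokernel[OF opp_abelian, of g f D B A] assms by simp

text \<open>\<open>exact_at\<close> only provides some \<open>k\<close> that is both a kernel of
  \<open>g\<close> and an image of \<open>f\<close>. As \<open>f\<close> is monic, it is a kernel of
  its cokernel \<open>c\<close>, so \<open>f\<close> and \<open>k\<close> factor through each other
  and \<open>f\<close> inherits from \<open>k\<close> the property of a kernel of
  \<open>g\<close>.\<close>

lemma short_exact_iff:
  assumes f: "f \<in> Hom C A B" and g: "g \<in> Hom C B D"
  shows "short_exact C f g \<longleftrightarrow> is_kernel C g f \<and> is_cokernel C f g"
proof
  assume "short_exact C f g"
  then obtain k c where mono: "monic C f" and epi: "epic C g" and k: "is_kernel C g k"
    and c: "is_cokernel C f c" and kc: "is_kernel C c k"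
    unfolding short_exact_def exact_at_def is_image_def by auto
  define K W where "K = Dom C k" and "W = Cod C c"
  have k': "k \<in> Hom C K B" using k g unfolding is_kernel_def K_def by (auto simp: Hom_iff)
  have c': "c \<in> Hom C B W" using c f unfolding is_cokernel_def W_def by (auto simp: Hom_iff)
  have fc: "is_kernel C c f" by (rule monic_kernel_of_cokernel[OF mono c f c'])
  obtain r where r: "r \<in> Hom C A K" "k \<cdot> r = f"
    using kernel_factor[OF kc k' c' f kernel_zero[OF fc f c']] by auto
  obtain s where s: "s \<in> Hom C K A" "f \<cdot> s = k"
    using kernel_factor[OF fc f c' k' kernel_zero[OF kc k' c']] by auto
  have "g \<cdot> f = (g \<cdot> k) \<cdot> r" using r k' g by (auto simp: Hom_iff)
  then have gf: "g \<cdot> f = hzero C A D"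
    using r g k' f by (simp add: kernel_zero[OF k k' g] Hom_iff)
  have "is_kernel C g f"
  proof (rule kernelI[OF f g gf mono])
    fix V h assume h: "h \<in> Hom C V B" "g \<cdot> h = hzero C V D"
    obtain u where u: "u \<in> Hom C V K" "k \<cdot> u = h" using kernel_factor[OF k k' g h] by auto
    have "f \<cdot> (s \<cdot> u) = h" using s u f by (simp add: reassoc[OF s(2)] Hom_iff)
    then show "\<exists>u\<in>Hom C V A. f \<cdot> u = h" using compo_in[OF u(1) s(1)] by blast
  qed
  then show "is_kernel C g f \<and> is_cokernel C f g" using epic_cokernel_of_kernel[OF epi _ f g] by simp
next
  assume "is_kernel C g f \<and> is_cokernel C f g"
  then show "short_exact C f g"
    using kernel_monic[OF _ f g] cokernel_epic[OF _ f g] f g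
    unfolding short_exact_def exact_at_def is_image_def by (auto simp: Hom_iff)
qed

lemma ses_iff:
  "ses C A f B g D \<longleftrightarrow> f \<in> Hom C A B \<and> g \<in> Hom C B D \<and> is_kernel C g f \<and> is_cokernel C f g"
  using short_exact_iff unfolding ses_def by blast

lemma sesD:
  assumes "ses C A f B g D"
  shows "f \<in> Hom C A B" "g \<in> Hom C B D" "g \<cdot> f = hzero C A D" "monic C f" "epic C g"
  using assms kernel_zero kernel_monic cokernel_epic unfolding ses_iff by blast+

lemma ses_Obj:
  assumes "ses C A f B g D"
  shows "A \<in> Obj C" "B \<in> Obj C" "D \<in> Obj C"
  using sesD(1,2)[OF assms] Hom_Obj by blast+

lemma ses_lift:
  assumes "ses C A f B g D" "h \<in> Hom C W B" "g \<cdot> h = hzero C W D"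
  obtains u where "u \<in> Hom C W A" "f \<cdot> u = h"
  using assms kernel_factor unfolding ses_iff by blast

lemma ses_colift:
  assumes "ses C A f B g D" "h \<in> Hom C B W" "h \<cdot> f = hzero C A W"
  obtains u where "u \<in> Hom C D W" "u \<cdot> g = h"
  using assms cokernel_factor unfolding ses_iff by blast

lemma ses_opp: "ses (opp C) D g B f A \<longleftrightarrow> ses C A f B g D"
  using abelian_category.ses_iff[OF opp_abelian] ses_iff by auto

lemma sesI_kernel:
  assumes "f \<in> Hom C A B" "g \<in> Hom C B D" "g \<cdot> f = hzero C A D" "monic C f" "epic C g"
    and "\<And>W h. h \<in> Hom C W B \<Longrightarrow> g \<cdot> h = hzero C W D \<Longrightarrow> \<exists>u\<in>Hom C W A. f \<cdot> u = h"
  shows "ses C A f B g D"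
proof -
  have "is_kernel C g f" by (rule kernelI[OF assms(1-4)]) (fact assms(6))
  then show ?thesis using epic_cokernel_of_kernel assms(1,2,5) unfolding ses_iff by blast
qed

lemma sesI_cokernel:
  assumes "f \<in> Hom C A B" "g \<in> Hom C B D" "g \<cdot> f = hzero C A D" "monic C f" "epic C g"
    and "\<And>W h. h \<in> Hom C B W \<Longrightarrow> h \<cdot> f = hzero C A W \<Longrightarrow> \<exists>u\<in>Hom C D W. u \<cdot> g = h"
  shows "ses C A f B g D"
proof -
  have "is_cokernel C f g" by (rule cokernelI[OF assms(1-3,5)]) (fact assms(6))
  then show ?thesis using monic_kernel_of_cokernel assms(1,2,4) unfolding ses_iff by blast
qed

lemma ses_of_monic:
  assumes "monic C f" "f \<in> Hom C A B"
  obtains g D where "ses C A f B g D"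
proof -
  obtain g where g: "is_cokernel C f g" using ex_cokernel assms(2) by (auto simp: Hom_iff)
  then have "g \<in> Hom C B (Cod C g)" using assms(2) unfolding is_cokernel_def by (auto simp: Hom_iff)
  then show ?thesis using that monic_kernel_of_cokernel[OF assms(1) g assms(2)] g assms unfolding ses_iff by blast
qed

lemma ses_of_epic:
  assumes "epic C g" "g \<in> Hom C B D"
  obtains f A where "ses C A f B g D"
proof -
  obtain f where f: "is_kernel C g f" using ex_kernel assms(2) by (auto simp: Hom_iff)
  then have "f \<in> Hom C (Dom C f) B" using assms(2) unfolding is_kernel_def by (auto simp: Hom_iff)
  then show ?thesis using that epic_cokernel_of_kernel[OF assms(1) f _ assms(2)] f assms unfolding ses_iff by blast
qed

text \<open>The arrows \<open>g\<close>, \<open>e\<close> and the identity of \<open>X\<close> form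
  a morphism from the extension of \<open>X\<close> by \<open>B1\<close> to that of \<open>X\<close>
  by \<open>D\<close>. As in the snake lemma, \<open>e\<close> is then epic like \<open>g\<close>,
  and its kernel is the kernel \<open>U\<close> of \<open>g\<close>, embedded by
  \<open>j \<cdot> u\<close>.\<close>

lemma splice_factorization:
  assumes "ses C U u B1 g D" "ses C D h B2 p X" "j \<in> Hom C B1 E" "e \<in> Hom C E B2" "e \<cdot> j = h \<cdot> g"
    and "ses C B1 j E (p \<cdot> e) X"
  shows "ses C U (j \<cdot> u) E e B2"
proof -
  note T = sesD[OF assms(1)] sesD[OF assms(2)] assms(3,4) sesD(4,5)[OF assms(6)]
  note O = ses_Obj[OF assms(1)] ses_Obj[OF assms(2)] ses_Obj[OF assms(6)]
  have ej: "e \<cdot> (j \<cdot> x) = h \<cdot> (g \<cdot> x)" if "x \<in> Hom C W B1" for x W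
    using that T by (simp add: reassoc[OF assms(5)] Hom_iff)
  show ?thesis
  proof (rule sesI_kernel)
    show "j \<cdot> u \<in> Hom C U E" "e \<in> Hom C E B2" using T by (auto simp: Hom_iff)
    show "e \<cdot> (j \<cdot> u) = hzero C U B2" using T O by (simp add: ej[of u U] Hom_iff)
    show "monic C (j \<cdot> u)"
    proof (rule monicI[of _ U E])
      fix W x assume x: "x \<in> Hom C W U" "(j \<cdot> u) \<cdot> x = hzero C W E"
      have ux: "u \<cdot> x \<in> Hom C W B1" using x T by (auto simp: Hom_iff)
      have "j \<cdot> (u \<cdot> x) = hzero C W E" using x T by (auto simp: Hom_iff)
      then have "u \<cdot> x = hzero C W B1" using monic_zeroD T ux by blast
      then show "x = hzero C W U" using monic_zeroD T x by blast
    qed (use T in \<open>auto simp: Hom_iff\<close>)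
    show "epic C e"
    proof (rule epicI[of _ E B2])
      \<comment> \<open>A test arrow \<open>t\<close> that kills \<open>e\<close> also kills
        \<open>h\<close>, as \<open>g\<close> is epic, so it is \<open>s \<cdot> p\<close>; then
        \<open>s\<close> kills the epic \<open>p \<cdot> e\<close>.\<close>
      fix W t assume t: "t \<in> Hom C B2 W" "t \<cdot> e = hzero C E W"
      have th: "t \<cdot> h \<in> Hom C D W" using t T by (auto simp: Hom_iff)
      have "(t \<cdot> h) \<cdot> g = (t \<cdot> e) \<cdot> j" using t(1) T by (simp add: assms(5) Hom_iff)
      also have "\<dots> = hzero C B1 W" using t T by (simp add: Hom_iff)
      finally have "t \<cdot> h = hzero C D W" using epic_zeroD T th by blast
      then obtain s where s: "s \<in> Hom C X W" "s \<cdot> p = t" using ses_colift assms(2) t(1) by blast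
      have "s \<cdot> (p \<cdot> e) = hzero C E W" using s t T by (simp add: reassoc[OF s(2)] Hom_iff)
      then have "s = hzero C X W" using epic_zeroD[OF T(14) sesD(2)[OF assms(6)]] s by blast
      then show "t = hzero C B2 W" using s T by (auto simp: Hom_iff)
    qed (use T in auto)
    \<comment> \<open>Exactness at \<open>E\<close>: \<open>x\<close> comes from \<open>B1\<close>
      because \<open>p \<cdot> e\<close> kills it, and there from the kernel \<open>U\<close> of
      \<open>g\<close> because \<open>h\<close> is monic.\<close>
    fix W x assume x: "x \<in> Hom C W E" "e \<cdot> x = hzero C W B2"
    have "(p \<cdot> e) \<cdot> x = hzero C W X" using x T by (auto simp: Hom_iff)
    then obtain y where y: "y \<in> Hom C W B1" "j \<cdot> y = x" using ses_lift assms(6) x(1) by blast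
    have gy: "g \<cdot> y \<in> Hom C W D" using y T by (auto simp: Hom_iff)
    have "h \<cdot> (g \<cdot> y) = hzero C W B2" using ej[OF y(1)] y x by simp
    then have "g \<cdot> y = hzero C W D" using monic_zeroD T gy by blast
    then obtain z where z: "z \<in> Hom C W U" "u \<cdot> z = y" using ses_lift assms(1) y(1) by blast
    have "(j \<cdot> u) \<cdot> z = x" using z y T by (auto simp: Hom_iff)
    then show "\<exists>v\<in>Hom C W U. (j \<cdot> u) \<cdot> v = x" using z by blast
  qed
qed

text \<open>The converse is the same chase in the opposite category, where \<open>U\<close> and
  \<open>X\<close>, \<open>g\<close> and \<open>h\<close>, and \<open>j\<close> and \<open>e\<close>
  trade places.\<close>

lemma splice_factorization_iff:
  assumes "ses C U u B1 g D" "ses C D h B2 p X" "j \<in> Hom C B1 E" "e \<in> Hom C E B2" "e \<cdot> j = h \<cdot> g"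
  shows "ses C B1 j E (p \<cdot> e) X \<longleftrightarrow> ses C U (j \<cdot> u) E e B2"
  using splice_factorization[OF assms] assms
    abelian_category.splice_factorization[OF opp_abelian, of X p B2 h D g B1 u U e E j]
  by (auto simp: ses_opp)

section \<open>Biproducts, pushouts and pullbacks of extensions\<close>

lemma biproduct_ses:
  assumes "is_biproduct C X Y i1 i2 p1 p2"
  obtains S where "ses C X i1 S p2 Y" "i2 \<in> Hom C Y S" "p1 \<in> Hom C S X"
    "p1 \<cdot> i1 = idn C X" "p2 \<cdot> i2 = idn C Y" "p1 \<cdot> i2 = hzero C Y X"
    "i1 \<cdot> p1 \<boxplus> i2 \<cdot> p2 = idn C S"
proof -
  obtain S where S: "i1 \<in> Hom C X S" "i2 \<in> Hom C Y S" "p1 \<in> Hom C S X" "p2 \<in> Hom C S Y"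
    and e: "p1 \<cdot> i1 = idn C X" "p2 \<cdot> i2 = idn C Y" "p2 \<cdot> i1 = hzero C X Y" "p1 \<cdot> i2 = hzero C Y X"
      "i1 \<cdot> p1 \<boxplus> i2 \<cdot> p2 = idn C S"
    using assms unfolding is_biproduct_def by auto
  have "ses C X i1 S p2 Y"
  proof (rule sesI_kernel[OF S(1,4) e(3)])
    show "monic C i1"
    proof (rule monicI[OF S(1)])
      fix W u assume u: "u \<in> Hom C W X" "i1 \<cdot> u = hzero C W S"
      have "u = p1 \<cdot> (i1 \<cdot> u)" using u(1) S by (simp add: reassoc[OF e(1)] Hom_iff)
      then show "u = hzero C W X" using u S by (simp add: Hom_iff)
    qed
    show "epic C p2"
    proof (rule epicI[OF S(4)])
      fix W u assume u: "u \<in> Hom C Y W" "u \<cdot> p2 = hzero C S W"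
      have "u = (u \<cdot> p2) \<cdot> i2" using u(1) S e(2) by (simp add: Hom_iff)
      then show "u = hzero C Y W" using u S by (simp add: Hom_iff)
    qed
    fix W h assume h: "h \<in> Hom C W S" "p2 \<cdot> h = hzero C W Y"
    have "h = (i1 \<cdot> p1 \<boxplus> i2 \<cdot> p2) \<cdot> h" unfolding e(5) using h(1) by (simp add: Hom_iff)
    also have "\<dots> = i1 \<cdot> (p1 \<cdot> h)" using h S by (simp add: Hom_iff)
    finally show "\<exists>u\<in>Hom C W X. i1 \<cdot> u = h" using compo_in[OF h(1) S(3)] by metis
  qed
  then show ?thesis using that S e by blast
qed

text \<open>\<open>E'\<close> is the cokernel of the arrow \<open>(i, -a)\<close> from
  \<open>Z\<close> to the biproduct of \<open>E\<close> and \<open>Z'\<close>. The universal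
  property is returned along with the extension, because later arrows out of \<open>E'\<close> are
  built and compared by it.\<close>

lemma ex_pushout:
  assumes iq: "ses C Z i E q X" and a: "a \<in> Hom C Z Z'"
  obtains E' i' m q' where "ses C Z' i' E' q' X" "m \<in> Hom C E E'" "m \<cdot> i = i' \<cdot> a" "q' \<cdot> m = q"
    "\<And>T x y. x \<in> Hom C E T \<Longrightarrow> y \<in> Hom C Z' T \<Longrightarrow> x \<cdot> i = y \<cdot> a \<Longrightarrow>
       \<exists>w\<in>Hom C E' T. w \<cdot> m = x \<and> w \<cdot> i' = y"
    "\<And>T v w. v \<in> Hom C E' T \<Longrightarrow> w \<in> Hom C E' T \<Longrightarrow> v \<cdot> m = w \<cdot> m \<Longrightarrow> v \<cdot> i' = w \<cdot> i' \<Longrightarrow> v = w"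
proof -
  note T = sesD[OF iq] ses_Obj[OF iq] a Hom_Obj(2)[OF a]
  obtain a' where a': "a' \<in> Hom C Z Z'" "a \<boxplus> a' = hzero C Z Z'" using ex_negative[OF a] by auto
  obtain i1 i2 p1 p2 where bp: "is_biproduct C E Z' i1 i2 p1 p2" using ex_biproduct T by metis
  obtain S where S: "i1 \<in> Hom C E S" "i2 \<in> Hom C Z' S" "p1 \<in> Hom C S E" "p2 \<in> Hom C S Z'"
    and mi2: "monic C i2" and e: "p1 \<cdot> i1 = idn C E" "p2 \<cdot> i2 = idn C Z'" "p2 \<cdot> i1 = hzero C E Z'"
      "p1 \<cdot> i2 = hzero C Z' E" "i1 \<cdot> p1 \<boxplus> i2 \<cdot> p2 = idn C S"
  proof -
    obtain S where S: "i1 \<in> Hom C E S" "i2 \<in> Hom C Z' S" "p1 \<in> Hom C S E" "p2 \<in> Hom C S Z'"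
      and e: "p1 \<cdot> i1 = idn C E" "p2 \<cdot> i2 = idn C Z'" "p2 \<cdot> i1 = hzero C E Z'"
      "p1 \<cdot> i2 = hzero C Z' E" "i1 \<cdot> p1 \<boxplus> i2 \<cdot> p2 = idn C S"
      using bp unfolding is_biproduct_def by auto
    have "monic C i2"
    proof (rule monicI[OF S(2)])
      fix W u assume u: "u \<in> Hom C W Z'" "i2 \<cdot> u = hzero C W S"
      have "u = p2 \<cdot> (i2 \<cdot> u)" using u(1) S by (simp add: reassoc[OF e(2)] Hom_iff)
      then show "u = hzero C W Z'" using u S by (simp add: Hom_iff)
    qed
    then show ?thesis using that S e by blast
  qed
  have SO: "S \<in> Obj C" using Hom_Obj[OF S(1)] by simp
  \<comment> \<open>The arrow \<open>(i, -a)\<close>, with \<open>a'\<close> in the role of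
    \<open>-a\<close>. Its composite with \<open>p1\<close> is the monic \<open>i\<close>, hence it
    is monic.\<close>
  define k where "k = i1 \<cdot> i \<boxplus> i2 \<cdot> a'"
  have k: "k \<in> Hom C Z S" using S T a' SO by (simp add: k_def Hom_iff)
  have p1k: "p1 \<cdot> k = i"
    using S T a' SO by (simp add: k_def reassoc[OF e(1)] reassoc[OF e(4)] Hom_iff)
  have mk: "monic C k"
  proof (rule monicI[OF k])
    fix W u assume u: "u \<in> Hom C W Z" "k \<cdot> u = hzero C W S"
    have "i \<cdot> u = p1 \<cdot> (k \<cdot> u)" using u(1) S k by (simp add: reassoc[OF p1k] Hom_iff)
    then have "i \<cdot> u = hzero C W E" using u S by (simp add: Hom_iff)
    then show "u = hzero C W Z" using monic_zeroD T u(1) by blast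
  qed
  obtain c E' where c: "ses C Z k S c E'" using ses_of_monic[OF mk k] .
  note c' = sesD[OF c] ses_Obj[OF c]
  define m i' where "m = c \<cdot> i1" and "i' = c \<cdot> i2"
  have m: "m \<in> Hom C E E'" and i': "i' \<in> Hom C Z' E'" using S c' by (auto simp: m_def i'_def Hom_iff)
  \<comment> \<open>An arrow out of \<open>E'\<close> is determined by its composites with
    \<open>m\<close> and \<open>i'\<close>; this yields \<open>uniq\<close>.\<close>
  have wc: "w \<cdot> c = (w \<cdot> m) \<cdot> p1 \<boxplus> (w \<cdot> i') \<cdot> p2" if w: "w \<in> Hom C E' T" for w T
  proof -
    have "w \<cdot> c = (w \<cdot> c) \<cdot> (i1 \<cdot> p1 \<boxplus> i2 \<cdot> p2)" unfolding e(5) using w c' by (simp add: Hom_iff)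
    then show ?thesis using w c' S by (simp add: m_def i'_def Hom_iff)
  qed
  have mi: "m \<cdot> i = i' \<cdot> a"
  proof (rule hadd_right_cancel)
    have "m \<cdot> i \<boxplus> i' \<cdot> a' = c \<cdot> k" using S T a' c' by (simp add: k_def m_def i'_def Hom_iff)
    also have "\<dots> = i' \<cdot> (a \<boxplus> a')" using a' i' c' by (simp add: Hom_iff)
    also have "\<dots> = i' \<cdot> a \<boxplus> i' \<cdot> a'" using a a'(1) i' by (simp add: Hom_iff)
    finally show "m \<cdot> i \<boxplus> i' \<cdot> a' = i' \<cdot> a \<boxplus> i' \<cdot> a'" .
  qed (use a a' i' m T in \<open>auto simp: Hom_iff\<close>)
  have univ: "\<exists>w\<in>Hom C E' T. w \<cdot> m = x \<and> w \<cdot> i' = y"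
    if x: "x \<in> Hom C E T" and y: "y \<in> Hom C Z' T" and xy: "x \<cdot> i = y \<cdot> a" for T x y
  proof -
    have xp: "x \<cdot> p1 \<boxplus> y \<cdot> p2 \<in> Hom C S T" using x y S by (simp add: Hom_iff)
    have p2k: "p2 \<cdot> k = a'" using S T a' SO by (simp add: k_def reassoc[OF e(2)] reassoc[OF e(3)] Hom_iff)
    have "(x \<cdot> p1 \<boxplus> y \<cdot> p2) \<cdot> k = y \<cdot> a \<boxplus> y \<cdot> a'" using x y S k by (simp add: p1k p2k xy Hom_iff)
    also have "\<dots> = y \<cdot> (a \<boxplus> a')" using y a a'(1) by (simp add: Hom_iff)
    also have "\<dots> = hzero C Z T" using y a' T by (simp add: Hom_iff)
    finally obtain w where w: "w \<in> Hom C E' T" "w \<cdot> c = x \<cdot> p1 \<boxplus> y \<cdot> p2" using ses_colift[OF c xp] by blast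
    have "w \<cdot> m = x" "w \<cdot> i' = y"
      using w(1) c' S x y T by (simp_all add: m_def i'_def reassoc[OF w(2)] e Hom_iff)
    then show ?thesis using w by blast
  qed
  have uniq: "v = w"
    if "v \<in> Hom C E' T" "w \<in> Hom C E' T" "v \<cdot> m = w \<cdot> m" "v \<cdot> i' = w \<cdot> i'" for T v w
  proof -
    have "v \<cdot> c = w \<cdot> c" using wc that by simp
    then show ?thesis using epicD that c' by blast
  qed
  \<comment> \<open>\<open>q'\<close> is induced by \<open>q\<close> on \<open>E\<close> and by zero
    on \<open>Z'\<close>.\<close>
  obtain q' where q': "q' \<in> Hom C E' X" "q' \<cdot> m = q" "q' \<cdot> i' = hzero C Z' X"
    using univ[of q X "hzero C Z' X"] T by (auto simp: Hom_iff)
  have epi: "epic C q'"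
  proof (rule epicI[OF q'(1)])
    fix W s assume s: "s \<in> Hom C X W" "s \<cdot> q' = hzero C E' W"
    have "s \<cdot> q = (s \<cdot> q') \<cdot> m" using s(1) q' m by (simp add: Hom_iff)
    then have "s \<cdot> q = hzero C E W" using s m by (simp add: Hom_iff)
    then show "s = hzero C X W" using epic_zeroD T s(1) by blast
  qed
  have mono: "monic C i'"
  proof (rule monicI[OF i'])
    \<comment> \<open>If \<open>i'\<close> kills \<open>t\<close>, then \<open>i2 \<cdot> t\<close>
      is \<open>k \<cdot> s\<close> for some \<open>s\<close> into \<open>Z\<close>. Comparing first
      components, \<open>i \<cdot> s\<close> is zero, hence so are \<open>s\<close> and
      \<open>t\<close>.\<close>
    fix W t assume t: "t \<in> Hom C W Z'" "i' \<cdot> t = hzero C W E'"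
    have i2t: "i2 \<cdot> t \<in> Hom C W S" "c \<cdot> (i2 \<cdot> t) = hzero C W E'"
      using t S c' by (auto simp: i'_def Hom_iff)
    obtain s where s: "s \<in> Hom C W Z" "k \<cdot> s = i2 \<cdot> t" using ses_lift[OF c i2t] .
    have "i \<cdot> s = p1 \<cdot> (k \<cdot> s)" using s(1) S k by (simp add: reassoc[OF p1k] Hom_iff)
    also have "\<dots> = hzero C W E" unfolding s(2) using t(1) S T by (simp add: reassoc[OF e(4)] Hom_iff)
    finally have "s = hzero C W Z" using monic_zeroD T s(1) by blast
    then have "i2 \<cdot> t = hzero C W S" using s k by (auto simp: Hom_iff)
    then show "t = hzero C W Z'" using monic_zeroD mi2 S t by blast
  qed
  have "ses C Z' i' E' q' X"
  proof (rule sesI_cokernel[OF i' q'(1,3) mono epi])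
    fix W t assume t: "t \<in> Hom C E' W" "t \<cdot> i' = hzero C Z' W"
    \<comment> \<open>The restriction \<open>t \<cdot> m\<close> to \<open>E\<close> vanishes on
      \<open>Z\<close>, so it descends along \<open>q\<close> to some \<open>s\<close>; uniqueness
      identifies \<open>s \<cdot> q'\<close> with \<open>t\<close>.\<close>
    have tm: "t \<cdot> m \<in> Hom C E W" using t m by (simp add: Hom_iff)
    have "(t \<cdot> m) \<cdot> i = (t \<cdot> i') \<cdot> a" using t(1) m i' T by (simp add: mi Hom_iff)
    then have "(t \<cdot> m) \<cdot> i = hzero C Z W" using t T by (simp add: Hom_iff)
    then obtain s where s: "s \<in> Hom C X W" "s \<cdot> q = t \<cdot> m" using ses_colift[OF iq tm] by blast
    have "s \<cdot> q' = t"
    proof (rule uniq)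
      show "(s \<cdot> q') \<cdot> m = t \<cdot> m" using s q' m by (simp add: Hom_iff)
      show "(s \<cdot> q') \<cdot> i' = t \<cdot> i'" using s(1) q' i' t T by (simp add: Hom_iff)
    qed (use s q' t in \<open>auto simp: Hom_iff\<close>)
    then show "\<exists>s\<in>Hom C X W. s \<cdot> q' = t" using s by blast
  qed
  then show ?thesis using that m mi q'(2) univ uniq by blast
qed

text \<open>This is the pushout of the sequence read in the opposite category.\<close>

lemma ex_pullback:
  assumes "ses C Z i E q X" "c \<in> Hom C X' X"
  obtains E' i' m q' where "ses C Z i' E' q' X'" "m \<in> Hom C E' E" "q \<cdot> m = c \<cdot> q'" "m \<cdot> i' = i"
    "\<And>T x y. x \<in> Hom C T E \<Longrightarrow> y \<in> Hom C T X' \<Longrightarrow> q \<cdot> x = c \<cdot> y \<Longrightarrow>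
       \<exists>w\<in>Hom C T E'. m \<cdot> w = x \<and> q' \<cdot> w = y"
    "\<And>T v w. v \<in> Hom C T E' \<Longrightarrow> w \<in> Hom C T E' \<Longrightarrow> m \<cdot> v = m \<cdot> w \<Longrightarrow> q' \<cdot> v = q' \<cdot> w \<Longrightarrow> v = w"
proof -
  have "ses (opp C) X q E i Z" "c \<in> Hom (opp C) X X'" using assms by (simp_all add: ses_opp)
  then show thesis
  proof (rule abelian_category.ex_pushout[OF opp_abelian], goal_cases)
    case (1 E' q' m i')
    show thesis
    proof (rule that)
      show "ses C Z i' E' q' X'" "m \<in> Hom C E' E" "q \<cdot> m = c \<cdot> q'" "m \<cdot> i' = i"
        using 1(1-4) by (simp_all add: ses_opp)
      show "\<exists>w\<in>Hom C T E'. m \<cdot> w = x \<and> q' \<cdot> w = y"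
        if "x \<in> Hom C T E" "y \<in> Hom C T X'" "q \<cdot> x = c \<cdot> y" for T x y
        using 1(5)[of x T y] that by simp
      show "v = w"
        if "v \<in> Hom C T E'" "w \<in> Hom C T E'" "m \<cdot> v = m \<cdot> w" "q' \<cdot> v = q' \<cdot> w" for T v w
        using 1(6)[of v T w] that by simp
    qed
  qed
qed

text \<open>An extension of \<open>g\<close> to an arrow \<open>r\<close> on \<open>E\<close> is
  what a splitting of the pushout along \<open>g\<close> amounts to. The kernel \<open>K\<close> of
  \<open>r\<close> meets \<open>B\<close> in the kernel \<open>A\<close> of \<open>g\<close>, and
  \<open>K\<close> and \<open>B\<close> together span \<open>E\<close> because \<open>r\<close> is
  already epic on \<open>B\<close>; so \<open>K\<close> is an extension of \<open>M\<close> by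
  \<open>A\<close>.\<close>

lemma ses_kernel_of_extension:
  assumes iq: "ses C B i E q M" and fg: "ses C A f B g D" and r: "r \<in> Hom C E D" "r \<cdot> i = g"
  obtains K k a where "ses C A a K (q \<cdot> k) M" "k \<in> Hom C K E" "k \<cdot> a = i \<cdot> f"
proof -
  note T = sesD[OF iq] sesD[OF fg] ses_Obj[OF iq] ses_Obj[OF fg]
  have "epic C r"
  proof (rule epicI[OF r(1)])
    fix W u assume u: "u \<in> Hom C D W" "u \<cdot> r = hzero C E W"
    have "u \<cdot> g = (u \<cdot> r) \<cdot> i" using u(1) r T by (simp add: Hom_iff)
    then have "u \<cdot> g = hzero C B W" using u T by (simp add: Hom_iff)
    then show "u = hzero C D W" using epic_zeroD T u(1) by blast
  qed
  then obtain k K where k: "ses C K k E r D" using ses_of_epic r(1) by blast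
  note k' = sesD[OF k] ses_Obj[OF k]
  have "i \<cdot> f \<in> Hom C A E" "r \<cdot> (i \<cdot> f) = hzero C A D"
    using T r(1) by (auto simp: reassoc[OF r(2)] Hom_iff)
  then obtain a where a: "a \<in> Hom C A K" "k \<cdot> a = i \<cdot> f" using ses_lift[OF k] by blast
  have qk: "q \<cdot> k \<in> Hom C K M" using T k' by (simp add: Hom_iff)
  have "ses C A a K (q \<cdot> k) M"
  proof (rule sesI_kernel[OF a(1) qk])
    have "(q \<cdot> k) \<cdot> a = (q \<cdot> i) \<cdot> f" using a T(1,2,6) k' by (simp add: Hom_iff)
    then show "(q \<cdot> k) \<cdot> a = hzero C A M" using T by (simp add: Hom_iff)
    show "monic C a"
    proof (rule monicI[OF a(1)])
      fix W u assume u: "u \<in> Hom C W A" "a \<cdot> u = hzero C W K"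
      have fu: "f \<cdot> u \<in> Hom C W B" using u T by (simp add: Hom_iff)
      have "i \<cdot> (f \<cdot> u) = k \<cdot> (a \<cdot> u)" using u(1) a(1) T k' by (simp add: reassoc[OF a(2)] Hom_iff)
      then have "i \<cdot> (f \<cdot> u) = hzero C W E" using u k' by (simp add: Hom_iff)
      then have "f \<cdot> u = hzero C W B" using monic_zeroD T fu by blast
      then show "u = hzero C W A" using monic_zeroD T u by blast
    qed
    show "epic C (q \<cdot> k)"
    proof (rule epicI[OF qk])
      fix W t assume t: "t \<in> Hom C M W" "t \<cdot> (q \<cdot> k) = hzero C K W"
      \<comment> \<open>\<open>t \<cdot> q\<close> vanishes on the kernel of \<open>r\<close>, so it
        is \<open>s \<cdot> r\<close>; restricting along \<open>i\<close> shows that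
        \<open>s\<close> kills the epic \<open>g\<close>.\<close>
      have tq: "t \<cdot> q \<in> Hom C E W" "(t \<cdot> q) \<cdot> k = hzero C K W" using t T k' by (auto simp: Hom_iff)
      obtain s where s: "s \<in> Hom C D W" "s \<cdot> r = t \<cdot> q" using ses_colift[OF k tq] .
      have "s \<cdot> g = (s \<cdot> r) \<cdot> i" using s(1) r T by (simp add: Hom_iff)
      also have "\<dots> = hzero C B W" unfolding s(2) using t(1) T by (simp add: Hom_iff)
      finally have "s = hzero C D W" using epic_zeroD T s(1) by blast
      then have "t \<cdot> q = hzero C E W" using s r by (auto simp: Hom_iff)
      then show "t = hzero C M W" using epic_zeroD T t(1) by blast
    qed
    fix W x assume x: "x \<in> Hom C W K" "(q \<cdot> k) \<cdot> x = hzero C W M"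
    have "k \<cdot> x \<in> Hom C W E" "q \<cdot> (k \<cdot> x) = hzero C W M" using x T k' by (auto simp: Hom_iff)
    then obtain y where y: "y \<in> Hom C W B" "i \<cdot> y = k \<cdot> x" using ses_lift[OF iq] by blast
    have "g \<cdot> y = r \<cdot> (i \<cdot> y)" using y(1) r(1) T by (simp add: reassoc[OF r(2)] Hom_iff)
    also have "\<dots> = (r \<cdot> k) \<cdot> x" unfolding y(2) using x(1) k'(1,2) r by (simp add: Hom_iff)
    also have "\<dots> = hzero C W D" using k' x(1) by (simp add: Hom_iff)
    finally obtain z where z: "z \<in> Hom C W A" "f \<cdot> z = y" using ses_lift[OF fg y(1)] by blast
    have "k \<cdot> (a \<cdot> z) = k \<cdot> x"
      using z(1) a(1) T k' by (simp add: reassoc[OF a(2)] z(2) y(2) Hom_iff)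
    then have "a \<cdot> z = x" using monicD[OF k'(4,1) compo_in[OF z(1) a(1)] x(1)] by blast
    then show "\<exists>u\<in>Hom C W A. a \<cdot> u = x" using z by blast
  qed
  then show ?thesis using that k' a by blast
qed

text \<open>The inverse exists because \<open>m\<close> is monic and its cokernel is zero, so the
  identity of \<open>E'\<close> lifts along \<open>m\<close>.\<close>

lemma ses_short_five:
  assumes E: "ses C Z i E q X" and E': "ses C Z i' E' q' X" and m: "m \<in> Hom C E E'" "m \<cdot> i = i'" "q' \<cdot> m = q"
  obtains n where "n \<in> Hom C E' E" "n \<cdot> i' = i" "q \<cdot> n = q'"
proof -
  note T = sesD[OF E] ses_Obj[OF E] sesD[OF E'] ses_Obj[OF E']
  have mono: "monic C m"
  proof (rule monicI[OF m(1)])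
    fix W u assume u: "u \<in> Hom C W E" "m \<cdot> u = hzero C W E'"
    have "q \<cdot> u = q' \<cdot> (m \<cdot> u)" using u(1) T m(1) by (simp add: reassoc[OF m(3)] Hom_iff)
    then have "q \<cdot> u = hzero C W X" using u T by (simp add: Hom_iff)
    then obtain v where v: "v \<in> Hom C W Z" "i \<cdot> v = u" using ses_lift[OF E u(1)] by blast
    have "i' \<cdot> v = m \<cdot> (i \<cdot> v)" using v(1) T m(1) by (simp add: reassoc[OF m(2)] Hom_iff)
    then have "i' \<cdot> v = hzero C W E'" using u v by simp
    then have "v = hzero C W Z" using monic_zeroD T v(1) by blast
    then show "u = hzero C W E" using v T by (auto simp: Hom_iff)
  qed
  then obtain c K where c: "ses C E m E' c K" using ses_of_monic m(1) by blast
  note c' = sesD[OF c] ses_Obj[OF c]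
  \<comment> \<open>The cokernel \<open>c\<close> of \<open>m\<close> vanishes on \<open>Z\<close>,
    hence is \<open>s \<cdot> q'\<close>; and \<open>s\<close> kills the epic \<open>q\<close>,
    because \<open>s \<cdot> q\<close> is \<open>c \<cdot> m\<close>.\<close>
  have "c \<cdot> i' = (c \<cdot> m) \<cdot> i" using c'(1,2) T m by (simp add: Hom_iff)
  then have "c \<cdot> i' = hzero C Z K" using c' T by (simp add: Hom_iff)
  then obtain s where s: "s \<in> Hom C X K" "s \<cdot> q' = c" using ses_colift[OF E' c'(2)] by blast
  have "s \<cdot> q = (s \<cdot> q') \<cdot> m" using s(1) T m by (simp add: Hom_iff)
  then have "s \<cdot> q = hzero C E K" using s c' by simp
  then have "s = hzero C X K" using epic_zeroD T s(1) by blast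
  then have "c = hzero C E' K" using s T by (auto simp: Hom_iff)
  then have "idn C E' \<in> Hom C E' E'" "c \<cdot> idn C E' = hzero C E' K"
    using T c' by (simp_all add: Hom_iff)
  then obtain n where n: "n \<in> Hom C E' E" "m \<cdot> n = idn C E'" using ses_lift[OF c] by blast
  have "q \<cdot> n = q' \<cdot> (m \<cdot> n)" using n(1) T m(1) by (simp add: reassoc[OF m(3)] Hom_iff)
  then have qn: "q \<cdot> n = q'" using n T by (simp add: Hom_iff)
  have "m \<cdot> (n \<cdot> i') = m \<cdot> i" using n(1) m T by (simp add: reassoc[OF n(2)] Hom_iff)
  then have "n \<cdot> i' = i" using monicD[OF mono m(1) compo_in[OF T(9) n(1)] T(1)] by blast
  then show ?thesis using that n qn by blast
qed

end

section \<open>Ext in degree one\<close>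

text \<open>The lemmas on degree one are stated for \<open>Suc 0\<close>, to which the simplifier
  rewrites \<open>1\<close>.\<close>

lemma n_extensions_1:
  "E \<in> n_extensions C (Suc 0) X Z \<longleftrightarrow> (\<exists>f B g. E = [f, g] \<and> ses C Z f B g X)"
proof
  assume E: "E \<in> n_extensions C (Suc 0) X Z"
  then obtain f g where "E = [f, g]"
    unfolding n_extensions_def by (auto simp: length_Suc_conv)
  with E show "\<exists>f B g. E = [f, g] \<and> ses C Z f B g X"
    unfolding n_extensions_def ses_def short_exact_def by (auto simp: exact_at_def Hom_def)
next
  assume "\<exists>f B g. E = [f, g] \<and> ses C Z f B g X"
  then show "E \<in> n_extensions C (Suc 0) X Z"
    unfolding n_extensions_def ses_def short_exact_def by (auto simp: Hom_def)
qed

lemma ext_morphism_1: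
  assumes "ses C Z f B g X" "ses C Z' f' B' g' X'"
  shows "ext_morphism C a c [f, g] [f', g'] \<longleftrightarrow>
    a \<in> Hom C Z Z' \<and> c \<in> Hom C X X' \<and>
    (\<exists>m\<in>Hom C B B'. m \<cdot>\<^bsub>C\<^esub> f = f' \<cdot>\<^bsub>C\<^esub> a \<and> g' \<cdot>\<^bsub>C\<^esub> m = c \<cdot>\<^bsub>C\<^esub> g)"
  (is "?L \<longleftrightarrow> ?R")
proof -
  have T: "Dom C f = Z" "Cod C f = B" "Dom C g = B" "Cod C g = X"
    "Dom C f' = Z'" "Cod C f' = B'" "Dom C g' = B'" "Cod C g' = X'"
    using assms by (auto simp: ses_def Hom_def)
  show ?thesis
  proof
    assume ?L
    then obtain hs where hs: "length hs = 3" "hd hs = a" "last hs = c"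
      and c: "\<forall>i<2. hs ! i \<in> Hom C (Dom C ([f, g] ! i)) (Dom C ([f', g'] ! i)) \<and>
         hs ! Suc i \<in> Hom C (Cod C ([f, g] ! i)) (Cod C ([f', g'] ! i)) \<and>
         ([f', g'] ! i) \<cdot>\<^bsub>C\<^esub> (hs ! i) = (hs ! Suc i) \<cdot>\<^bsub>C\<^esub> ([f, g] ! i)"
      unfolding ext_morphism_def by (auto simp: numeral_eq_Suc)
    obtain m where "hs = [a, m, c]" using hs by (auto simp: length_Suc_conv numeral_eq_Suc)
    then show ?R using c[rule_format, of 0] c[rule_format, of 1] T by auto
  next
    assume ?R
    then obtain m where "a \<in> Hom C Z Z'" "c \<in> Hom C X X'" "m \<in> Hom C B B'"
      "m \<cdot>\<^bsub>C\<^esub> f = f' \<cdot>\<^bsub>C\<^esub> a" "g' \<cdot>\<^bsub>C\<^esub> m = c \<cdot>\<^bsub>C\<^esub> g" by auto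
    then show ?L unfolding ext_morphism_def
      by (intro conjI exI[of _ "[a, m, c]"]) (auto simp: T less_Suc_eq)
  qed
qed

lemma equiv_ext_equiv: "equiv (n_extensions C n X Z) (ext_equiv C n X Z)"
proof (rule equivI)
  have "sym ((ext_step C n X Z \<union> (ext_step C n X Z)\<inverse>)\<^sup>*)"
    by (intro sym_rtrancl sym_Un_converse)
  then show "sym (ext_equiv C n X Z)"
    unfolding ext_equiv_def by (auto simp: sym_def)
  show "trans (ext_equiv C n X Z)"
    unfolding ext_equiv_def by (intro transI) (auto intro: rtrancl_trans)
qed (auto simp: ext_equiv_def refl_on_def)

lemma carrier_Ext: "carrier (Ext C n X Z) = (\<lambda>E. ext_equiv C n X Z `` {E}) ` n_extensions C n X Z"
  by (auto simp: Ext_def quotient_def)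

text \<open>If \<open>d\<close> is an epimorphism \<open>B \<rightarrow> D\<close> followed by the kernel of \<open>p\<close>, then \<open>lifted C B d B2 p X\<close> says
  that the extension \<open>0 \<rightarrow> D \<rightarrow> B2 \<rightarrow> X \<rightarrow> 0\<close> is a pushout along \<open>B \<rightarrow> D\<close>. Since only the composite
  \<open>d\<close> occurs, this is directly a condition on a \<open>2\<close>-extension with arrows \<open>d\<close> and \<open>p\<close>.\<close>

definition lifted :: "('o, 'a) precat \<Rightarrow> 'o \<Rightarrow> 'a \<Rightarrow> 'o \<Rightarrow> 'a \<Rightarrow> 'o \<Rightarrow> bool" where
  "lifted C B d B2 p X \<longleftrightarrow>
     (\<exists>E j e. e \<in> Hom C E B2 \<and> e \<cdot>\<^bsub>C\<^esub> j = d \<and> ses C B j E (p \<cdot>\<^bsub>C\<^esub> e) X)"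

text \<open>The condition in which both sides of the theorem meet: for a fixed \<open>X\<close> it
  expresses right exactness of Ext1(X, -), and over all \<open>X\<close> it expresses that the
  category is hereditary.\<close>

definition extensions_lift :: "('o, 'a) precat \<Rightarrow> 'o \<Rightarrow> bool" where
  "extensions_lift C X \<longleftrightarrow>
     (\<forall>U u B1 g D h B2 p. ses C U u B1 g D \<longrightarrow> ses C D h B2 p X \<longrightarrow> lifted C B1 (h \<cdot>\<^bsub>C\<^esub> g) B2 p X)"

section \<open>Equivalence of extensions in degree one\<close>

context abelian_category
begin

lemma ext_morphism_1_comp:
  assumes E: "E \<in> n_extensions C (Suc 0) X Z" "E' \<in> n_extensions C (Suc 0) X' Z'"
    "E'' \<in> n_extensions C (Suc 0) X'' Z''"
    and m: "ext_morphism C a c E E'" "ext_morphism C a' c' E' E''"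
  shows "ext_morphism C (a' \<cdot> a) (c' \<cdot> c) E E''"
proof -
  obtain f B g f' B' g' f'' B'' g'' where
    e: "E = [f, g]" "E' = [f', g']" "E'' = [f'', g'']" and
    s: "ses C Z f B g X" "ses C Z' f' B' g' X'" "ses C Z'' f'' B'' g'' X''"
    using E unfolding n_extensions_1 by auto
  obtain m m' where
    1: "a \<in> Hom C Z Z'" "c \<in> Hom C X X'" "m \<in> Hom C B B'" and m: "m \<cdot> f = f' \<cdot> a" "g' \<cdot> m = c \<cdot> g" and
    2: "a' \<in> Hom C Z' Z''" "c' \<in> Hom C X' X''" "m' \<in> Hom C B' B''"
    and m': "m' \<cdot> f' = f'' \<cdot> a'" "g'' \<cdot> m' = c' \<cdot> g'"
    using m unfolding e ext_morphism_1[OF s(1,2)] ext_morphism_1[OF s(2,3)] by auto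
  note T = 1 2 sesD(1,2)[OF s(1)] sesD(1,2)[OF s(2)] sesD(1,2)[OF s(3)]
  have "(m' \<cdot> m) \<cdot> f = f'' \<cdot> (a' \<cdot> a)" "g'' \<cdot> (m' \<cdot> m) = (c' \<cdot> c) \<cdot> g"
    using T by (simp_all add: m reassoc[OF m'(1)] reassoc[OF m'(2)] Hom_iff)
  moreover have "a' \<cdot> a \<in> Hom C Z Z''" "c' \<cdot> c \<in> Hom C X X''" "m' \<cdot> m \<in> Hom C B B''"
    using compo_in T by blast+
  ultimately show ?thesis unfolding e ext_morphism_1[OF s(1,3)] by blast
qed

lemma n_extensions_1_Obj:
  assumes "E \<in> n_extensions C (Suc 0) X Z"
  shows "X \<in> Obj C" "Z \<in> Obj C"
  using assms ses_Obj unfolding n_extensions_1 by blast+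

lemma ext_step_1_refl:
  assumes "E \<in> n_extensions C (Suc 0) X Z"
  shows "(E, E) \<in> ext_step C (Suc 0) X Z"
proof -
  obtain f B g where e: "E = [f, g]" and s: "ses C Z f B g X" using assms unfolding n_extensions_1 by auto
  have "ext_morphism C (idn C Z) (idn C X) E E"
    unfolding e ext_morphism_1[OF s s] using sesD(1,2)[OF s] ses_Obj[OF s]
    by (intro conjI bexI[of _ "idn C B"]) (auto simp: Hom_iff)
  then show ?thesis using assms by (simp add: ext_step_def)
qed

lemma ext_step_1_sym:
  assumes "(E, E') \<in> ext_step C (Suc 0) X Z"
  shows "(E', E) \<in> ext_step C (Suc 0) X Z"
proof -
  obtain f B g f' B' g' where e: "E = [f, g]" "E' = [f', g']"
    and s: "ses C Z f B g X" "ses C Z f' B' g' X"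
    using assms unfolding ext_step_def n_extensions_1 by auto
  note T = sesD(1,2)[OF s(1)] sesD(1,2)[OF s(2)]
  obtain m where m: "m \<in> Hom C B B'" "m \<cdot> f = f'" "g' \<cdot> m = g"
    using assms T unfolding ext_step_def e by (auto simp: ext_morphism_1[OF s] idn_left idn_right)
  obtain n where n: "n \<in> Hom C B' B" "n \<cdot> f' = f" "g \<cdot> n = g'"
    using ses_short_five[OF s m] .
  have "ext_morphism C (idn C Z) (idn C X) E' E"
    unfolding e ext_morphism_1[OF s(2,1)] using T n ses_Obj[OF s(1)]
    by (intro conjI bexI[of _ n]) (auto simp: idn_left idn_right idn_in)
  then show ?thesis using assms by (simp add: ext_step_def)
qed

lemma ext_step_1_trans:
  assumes "(E, E') \<in> ext_step C (Suc 0) X Z" "(E', E'') \<in> ext_step C (Suc 0) X Z"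
  shows "(E, E'') \<in> ext_step C (Suc 0) X Z"
proof -
  have E: "E \<in> n_extensions C (Suc 0) X Z" "E' \<in> n_extensions C (Suc 0) X Z"
    "E'' \<in> n_extensions C (Suc 0) X Z"
    and m: "ext_morphism C (idn C Z) (idn C X) E E'" "ext_morphism C (idn C Z) (idn C X) E' E''"
    using assms by (auto simp: ext_step_def)
  show ?thesis
    using ext_morphism_1_comp[OF E m] E n_extensions_1_Obj[OF E(1)] by (simp add: ext_step_def)
qed

text \<open>In degree one, all morphisms of extensions fixing the ends are isomorphisms.\<close>

lemma ext_equiv_1: "ext_equiv C (Suc 0) X Z = ext_step C (Suc 0) X Z"
proof -
  have "(ext_step C (Suc 0) X Z)\<inverse> = ext_step C (Suc 0) X Z"
    using ext_step_1_sym by auto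
  moreover have "trans (ext_step C (Suc 0) X Z)"
    using ext_step_1_trans by (rule transI)
  ultimately have "ext_equiv C (Suc 0) X Z =
      (ext_step C (Suc 0) X Z)\<^sup>= \<inter> n_extensions C (Suc 0) X Z \<times> n_extensions C (Suc 0) X Z"
    unfolding ext_equiv_def by (simp add: rtrancl_trancl_reflcl trancl_id del: reflcl_trancl)
  then show ?thesis using ext_step_1_refl by (auto simp: ext_step_def)
qed

lemma ext_class_eq_1:
  assumes "E \<in> n_extensions C (Suc 0) X Z" "E' \<in> n_extensions C (Suc 0) X Z"
  shows "ext_equiv C (Suc 0) X Z `` {E} = ext_equiv C (Suc 0) X Z `` {E'} \<longleftrightarrow>
    ext_morphism C (idn C Z) (idn C X) E E'"
  using eq_equiv_class_iff[OF equiv_ext_equiv assms] assms by (simp add: ext_equiv_1 ext_step_def)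

section \<open>Pushing out extension classes\<close>

lemma ex_ext_push:
  assumes "E \<in> n_extensions C (Suc 0) X Z" "a \<in> Hom C Z Z'"
  obtains E' where "E' \<in> n_extensions C (Suc 0) X Z'" "ext_morphism C a (idn C X) E E'"
proof -
  obtain f B g where e: "E = [f, g]" and s: "ses C Z f B g X" using assms unfolding n_extensions_1 by auto
  obtain B' f' m g' where p: "ses C Z' f' B' g' X" "m \<in> Hom C B B'" "m \<cdot> f = f' \<cdot> a" "g' \<cdot> m = g"
    using ex_pushout[OF s assms(2)] by metis
  have "ext_morphism C a (idn C X) E [f', g']"
    unfolding e ext_morphism_1[OF s p(1)] using p assms(2) sesD(2)[OF s] ses_Obj[OF s]
    by (auto simp: idn_left idn_in)
  then show ?thesis using that p(1) unfolding n_extensions_1 by blast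
qed

text \<open>Any extension that receives a morphism over \<open>a\<close> from \<open>E\<close> also
  receives one from the pushout of \<open>E\<close> that fixes both ends. So \<open>E'\<close> and
  \<open>E''\<close> are both equivalent to the pushout.\<close>

lemma ext_push_unique:
  assumes E: "E \<in> n_extensions C (Suc 0) X Z" and a: "a \<in> Hom C Z Z'"
    and E': "E' \<in> n_extensions C (Suc 0) X Z'" "ext_morphism C a (idn C X) E E'"
    and E'': "E'' \<in> n_extensions C (Suc 0) X Z'" "ext_morphism C a (idn C X) E E''"
  shows "ext_morphism C (idn C Z') (idn C X) E' E''"
proof -
  obtain f B g where e: "E = [f, g]" and s: "ses C Z f B g X" using E unfolding n_extensions_1 by auto
  obtain P i m q where p: "ses C Z' i P q X" "m \<in> Hom C B P" "m \<cdot> f = i \<cdot> a" "q \<cdot> m = g"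
    and univ: "\<And>T x y. x \<in> Hom C B T \<Longrightarrow> y \<in> Hom C Z' T \<Longrightarrow> x \<cdot> f = y \<cdot> a \<Longrightarrow>
       \<exists>w\<in>Hom C P T. w \<cdot> m = x \<and> w \<cdot> i = y"
    and uniq: "\<And>T v w. v \<in> Hom C P T \<Longrightarrow> w \<in> Hom C P T \<Longrightarrow> v \<cdot> m = w \<cdot> m \<Longrightarrow> v \<cdot> i = w \<cdot> i \<Longrightarrow> v = w"
    by (rule ex_pushout[OF s a]) blast
  have step: "([i, q], F) \<in> ext_step C (Suc 0) X Z'"
    if F: "F \<in> n_extensions C (Suc 0) X Z'" "ext_morphism C a (idn C X) E F" for F
  proof -
    obtain f' B' g' where e': "F = [f', g']" and s': "ses C Z' f' B' g' X"
      using F(1) unfolding n_extensions_1 by auto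
    obtain n where n: "n \<in> Hom C B B'" "n \<cdot> f = f' \<cdot> a" "g' \<cdot> n = g"
      using F(2) sesD(2)[OF s] unfolding e e' ext_morphism_1[OF s s'] by (auto simp: idn_left)
    obtain w where w: "w \<in> Hom C P B'" "w \<cdot> m = n" "w \<cdot> i = f'"
      using univ[OF n(1) sesD(1)[OF s'] n(2)] by auto
    have "g' \<cdot> w = q"
    proof (rule uniq)
      show "(g' \<cdot> w) \<cdot> m = q \<cdot> m"
        using w(1) sesD(2)[OF s'] p(2) by (simp add: w(2) n(3) p(4) Hom_iff)
      show "(g' \<cdot> w) \<cdot> i = q \<cdot> i"
        using w(1) sesD(1,2)[OF s'] sesD(1,2)[OF p(1)]
        by (simp add: w(3) sesD(3)[OF p(1)] sesD(3)[OF s'] Hom_iff)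
    qed (use w(1) sesD(2)[OF s'] sesD(2)[OF p(1)] compo_in in blast)+
    then have "ext_morphism C (idn C Z') (idn C X) [i, q] F"
      unfolding e' ext_morphism_1[OF p(1) s']
      using w sesD[OF s'] sesD[OF p(1)] ses_Obj[OF s']
      by (intro conjI bexI[of _ w]) (auto simp: idn_left idn_right idn_in)
    moreover have "[i, q] \<in> n_extensions C (Suc 0) X Z'" using p(1) unfolding n_extensions_1 by blast
    ultimately show ?thesis using F by (simp add: ext_step_def)
  qed
  have "(E', E'') \<in> ext_step C (Suc 0) X Z'"
    using ext_step_1_trans[OF ext_step_1_sym[OF step[OF E']] step[OF E'']] .
  then show ?thesis by (simp add: ext_step_def)
qed

text \<open>\<open>ext_push\<close> collects the classes of all targets of morphisms over
  \<open>a\<close> from any representative. A morphism from another representative \<open>G\<close>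
  can be precomposed with the equivalence from \<open>E\<close> to \<open>G\<close>, so every target
  is equivalent to \<open>E'\<close>.\<close>

lemma ext_push_class:
  assumes E: "E \<in> n_extensions C (Suc 0) X Z" and a: "a \<in> Hom C Z Z'"
    and E': "E' \<in> n_extensions C (Suc 0) X Z'" "ext_morphism C a (idn C X) E E'"
  shows "ext_push C (Suc 0) X a (ext_equiv C (Suc 0) X Z `` {E}) = ext_equiv C (Suc 0) X Z' `` {E'}"
proof -
  let ?R = "ext_equiv C (Suc 0) X Z'"
  define S where "S = {F \<in> n_extensions C (Suc 0) X Z'.
    \<exists>G\<in>ext_equiv C (Suc 0) X Z `` {E}. ext_morphism C a (idn C X) G F}"
  have "(E, E) \<in> ext_equiv C (Suc 0) X Z" using ext_step_1_refl[OF E] by (simp add: ext_equiv_1)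
  then have "E' \<in> S" using E' by (auto simp: S_def)
  moreover have "(E', F) \<in> ?R" if FS: "F \<in> S" for F
  proof -
    obtain G where G: "(E, G) \<in> ext_step C (Suc 0) X Z" "ext_morphism C a (idn C X) G F"
      and F: "F \<in> n_extensions C (Suc 0) X Z'"
      using FS by (auto simp: S_def ext_equiv_1)
    have "ext_morphism C (a \<cdot> idn C Z) (idn C X \<cdot> idn C X) E F"
      using G E F by (intro ext_morphism_1_comp[where E' = G]) (auto simp: ext_step_def)
    then have "ext_morphism C a (idn C X) E F"
      using a n_extensions_1_Obj[OF E] by (simp add: idn_right Hom_iff)
    then have "ext_morphism C (idn C Z') (idn C X) E' F" using ext_push_unique[OF E a E' F] by blast
    then show ?thesis using E' F by (simp add: ext_equiv_1 ext_step_def)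
  qed
  ultimately have "?R `` S = ?R `` {E'}"
    using equiv_ext_equiv[of C "Suc 0" X Z'] unfolding equiv_def trans_def by blast
  moreover have "Cod C a = Z'" using a by (simp add: Hom_iff)
  ultimately show ?thesis by (simp add: ext_push_def S_def)
qed

section \<open>The split class and exactness in the middle\<close>

lemma is_biproduct_chosen:
  assumes "X \<in> Obj C" "Y \<in> Obj C"
  shows "is_biproduct C X Y (in1 C X Y) (in2 C X Y) (pr1 C X Y) (pr2 C X Y)"
proof -
  have "\<exists>t. case t of (i1, i2, p1, p2) \<Rightarrow> is_biproduct C X Y i1 i2 p1 p2"
    using ex_biproduct[OF assms] by auto
  then have "case biprod C X Y of (i1, i2, p1, p2) \<Rightarrow> is_biproduct C X Y i1 i2 p1 p2"
    unfolding biprod_def by (rule someI_ex)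
  then show ?thesis by (auto simp: in1_def in2_def pr1_def pr2_def split: prod.splits)
qed

lemma zero_extension_1:
  assumes "X \<in> Obj C" "Z \<in> Obj C"
  shows "zero_extension C (Suc 0) X Z \<in> n_extensions C (Suc 0) X Z"
  using biproduct_ses[OF is_biproduct_chosen[OF assms(2,1)]]
  unfolding n_extensions_1 zero_extension_def by auto

text \<open>The middle component of a morphism to the split extension is a pair of an arrow
  \<open>r\<close> to \<open>Z'\<close> and an arrow to \<open>X\<close>, of which the second is
  forced to be \<open>q\<close>. For \<open>a\<close> the identity this is the splitting
  criterion.\<close>

lemma ext_morphism_zero_iff:
  assumes s: "ses C Z i E q X" and a: "a \<in> Hom C Z Z'"
  shows "ext_morphism C a (idn C X) [i, q] (zero_extension C (Suc 0) X Z') \<longleftrightarrow>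
    (\<exists>r\<in>Hom C E Z'. r \<cdot> i = a)"
proof -
  have O: "X \<in> Obj C" "Z' \<in> Obj C" using ses_Obj[OF s] Hom_Obj[OF a] by auto
  obtain S where b: "ses C Z' (in1 C Z' X) S (pr2 C Z' X) X" "in2 C Z' X \<in> Hom C X S"
    "pr1 C Z' X \<in> Hom C S Z'" "pr1 C Z' X \<cdot> in1 C Z' X = idn C Z'" "pr2 C Z' X \<cdot> in2 C Z' X = idn C X"
    using biproduct_ses[OF is_biproduct_chosen[OF O(2,1)]] by metis
  note T = sesD(1,2)[OF s] sesD(1,2)[OF b(1)] b(2,3) a O ses_Obj[OF s]
  have "(\<exists>m\<in>Hom C E S. m \<cdot> i = in1 C Z' X \<cdot> a \<and> pr2 C Z' X \<cdot> m = idn C X \<cdot> q) \<longleftrightarrow>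
    (\<exists>r\<in>Hom C E Z'. r \<cdot> i = a)"
  proof (intro iffI; elim bexE conjE)
    fix m assume m: "m \<in> Hom C E S" "m \<cdot> i = in1 C Z' X \<cdot> a"
    have "(pr1 C Z' X \<cdot> m) \<cdot> i = a" using T m(1) by (simp add: m(2) reassoc[OF b(4)] Hom_iff)
    then show "\<exists>r\<in>Hom C E Z'. r \<cdot> i = a" using compo_in[OF m(1) b(3)] by blast
  next
    fix r assume r: "r \<in> Hom C E Z'" "r \<cdot> i = a"
    have "in1 C Z' X \<cdot> r \<boxplus> in2 C Z' X \<cdot> q \<in> Hom C E S" using T r by (simp add: Hom_iff)
    moreover have "(in1 C Z' X \<cdot> r \<boxplus> in2 C Z' X \<cdot> q) \<cdot> i = in1 C Z' X \<cdot> a"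
      using T r(1) by (simp add: r(2) sesD(3)[OF s] Hom_iff)
    moreover have "pr2 C Z' X \<cdot> (in1 C Z' X \<cdot> r \<boxplus> in2 C Z' X \<cdot> q) = idn C X \<cdot> q"
      using T r(1) by (simp add: reassoc[OF b(5)] reassoc[OF sesD(3)[OF b(1)]] Hom_iff)
    ultimately show "\<exists>m\<in>Hom C E S. m \<cdot> i = in1 C Z' X \<cdot> a \<and> pr2 C Z' X \<cdot> m = idn C X \<cdot> q" by blast
  qed
  then show ?thesis
    using a idn_in O by (simp add: zero_extension_def ext_morphism_1[OF s b(1)])
qed

lemma ext_push_carrier:
  assumes "a \<in> Hom C Z Z'" "x \<in> carrier (Ext C (Suc 0) M Z)"
  shows "ext_push C (Suc 0) M a x \<in> carrier (Ext C (Suc 0) M Z')"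
proof -
  obtain E where E: "E \<in> n_extensions C (Suc 0) M Z" "x = ext_equiv C (Suc 0) M Z `` {E}"
    using assms(2) unfolding carrier_Ext by blast
  obtain E' where E': "E' \<in> n_extensions C (Suc 0) M Z'" "ext_morphism C a (idn C M) E E'"
    using ex_ext_push[OF E(1) assms(1)] .
  show ?thesis using ext_push_class[OF E(1) assms(1) E'] E'(1) E(2) unfolding carrier_Ext by auto
qed

text \<open>Pushing out along \<open>f\<close> and then \<open>g\<close> is pushing out along
  \<open>g \<cdot> f\<close>, which is zero, and over a zero arrow there is always a morphism to the
  split extension. Conversely, if the pushout along \<open>g\<close> splits, then \<open>g\<close>
  extends to an arrow \<open>r\<close> on the middle object, and the kernel of \<open>r\<close>
  carries the required preimage.\<close>

lemma ext_push_kernel: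
  assumes M: "M \<in> Obj C" and s: "ses C A f B g D"
  shows "ext_push C (Suc 0) M f ` carrier (Ext C (Suc 0) M A) =
    kernel (Ext C (Suc 0) M B) (Ext C (Suc 0) M D) (ext_push C (Suc 0) M g)"
proof (intro equalityI subsetI)
  note T = sesD[OF s] ses_Obj[OF s]
  fix x assume "x \<in> ext_push C (Suc 0) M f ` carrier (Ext C (Suc 0) M A)"
  then obtain E where E: "E \<in> n_extensions C (Suc 0) M A"
    and x: "x = ext_push C (Suc 0) M f (ext_equiv C (Suc 0) M A `` {E})"
    unfolding carrier_Ext by blast
  obtain E' where E': "E' \<in> n_extensions C (Suc 0) M B" "ext_morphism C f (idn C M) E E'"
    using ex_ext_push[OF E T(1)] .
  obtain E'' where E'': "E'' \<in> n_extensions C (Suc 0) M D" "ext_morphism C g (idn C M) E' E''"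
    using ex_ext_push[OF E'(1) T(2)] .
  have 0: "hzero C A D \<in> Hom C A D" using T by (simp add: Hom_iff)
  have "ext_morphism C (hzero C A D) (idn C M) E E''"
    using ext_morphism_1_comp[OF E E'(1) E''(1) E'(2) E''(2)] T(3) M by simp
  moreover have "ext_morphism C (hzero C A D) (idn C M) E (zero_extension C (Suc 0) M D)"
  proof -
    obtain i P q where e: "E = [i, q]" and i: "ses C A i P q M" using E unfolding n_extensions_1 by auto
    have "hzero C P D \<in> Hom C P D" "hzero C P D \<cdot> i = hzero C A D"
      using T sesD(1)[OF i] by (auto simp: Hom_iff)
    then show ?thesis unfolding e ext_morphism_zero_iff[OF i 0] by blast
  qed
  ultimately have "ext_morphism C (idn C D) (idn C M) E'' (zero_extension C (Suc 0) M D)"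
    using ext_push_unique[OF E 0 E''(1) _ zero_extension_1[OF M T(8)]] by blast
  then have "ext_push C (Suc 0) M g x = \<one>\<^bsub>Ext C (Suc 0) M D\<^esub>"
    unfolding x ext_push_class[OF E T(1) E'] ext_push_class[OF E'(1) T(2) E'']
    using ext_class_eq_1[OF E''(1) zero_extension_1[OF M T(8)]] by (simp add: Ext_def)
  then show "x \<in> kernel (Ext C (Suc 0) M B) (Ext C (Suc 0) M D) (ext_push C (Suc 0) M g)"
    unfolding x ext_push_class[OF E T(1) E'] kernel_def carrier_Ext using E' by blast
next
  note T = sesD[OF s] ses_Obj[OF s]
  fix x assume "x \<in> kernel (Ext C (Suc 0) M B) (Ext C (Suc 0) M D) (ext_push C (Suc 0) M g)"
  then obtain E where E: "E \<in> n_extensions C (Suc 0) M B"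
    and x: "x = ext_equiv C (Suc 0) M B `` {E}" "ext_push C (Suc 0) M g x = \<one>\<^bsub>Ext C (Suc 0) M D\<^esub>"
    unfolding carrier_Ext kernel_def by blast
  obtain i P q where e: "E = [i, q]" and i: "ses C B i P q M" using E unfolding n_extensions_1 by auto
  obtain E' where E': "E' \<in> n_extensions C (Suc 0) M D" "ext_morphism C g (idn C M) E E'"
    using ex_ext_push[OF E T(2)] .
  have "ext_morphism C (idn C D) (idn C M) E' (zero_extension C (Suc 0) M D)"
    using x(2) ext_class_eq_1[OF E'(1) zero_extension_1[OF M T(8)]]
    unfolding x(1) ext_push_class[OF E T(2) E'] by (simp add: Ext_def)
  then have "ext_morphism C (idn C D \<cdot> g) (idn C M \<cdot> idn C M) E (zero_extension C (Suc 0) M D)"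
    using ext_morphism_1_comp[OF E E'(1) zero_extension_1[OF M T(8)] E'(2)] by blast
  then have "ext_morphism C g (idn C M) E (zero_extension C (Suc 0) M D)"
    using T M by (simp add: idn_left Hom_iff)
  then obtain r where r: "r \<in> Hom C P D" "r \<cdot> i = g" unfolding e ext_morphism_zero_iff[OF i T(2)] by auto
  obtain K k a where k: "ses C A a K (q \<cdot> k) M" "k \<in> Hom C K P" "k \<cdot> a = i \<cdot> f"
    using ses_kernel_of_extension[OF i s r] .
  have "ext_morphism C f (idn C M) [a, q \<cdot> k] E"
    unfolding e ext_morphism_1[OF k(1) i] using k T M sesD[OF k(1)]
    by (auto simp: idn_left idn_in)
  moreover have F: "[a, q \<cdot> k] \<in> n_extensions C (Suc 0) M A" using k(1) unfolding n_extensions_1 by blast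
  ultimately have "x = ext_push C (Suc 0) M f (ext_equiv C (Suc 0) M A `` {[a, q \<cdot> k]})"
    using ext_push_class[OF F T(1) E] x(1) by simp
  then show "x \<in> ext_push C (Suc 0) M f ` carrier (Ext C (Suc 0) M A)"
    using F unfolding carrier_Ext by blast
qed

text \<open>Exactness in the middle is automatic by \<open>ext_push_kernel\<close>, so right
  exactness is surjectivity for every epic \<open>g\<close>. The class of \<open>[h, p]\<close> has
  a preimage exactly when \<open>[h, p]\<close> receives a morphism \<open>(g, e, id)\<close> from
  an extension of \<open>M\<close> by \<open>B\<close>, and that is \<open>lifted\<close>.\<close>

lemma covariant_right_exact_iff:
  assumes M: "M \<in> Obj C"
  shows "Ext1_covariant_right_exact C M \<longleftrightarrow> extensions_lift C M"
proof
  assume ex: "Ext1_covariant_right_exact C M"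
  show "extensions_lift C M"
    unfolding extensions_lift_def
  proof (intro allI impI)
    fix U u B g D h P p
    assume u: "ses C U u B g D" and h: "ses C D h P p M"
    note T = sesD[OF u] ses_Obj[OF u]
    have D: "Dom C g = B" "Cod C g = D" using T by (auto simp: Hom_iff)
    have H: "[h, p] \<in> n_extensions C (Suc 0) M D" using h unfolding n_extensions_1 by blast
    have "ext_push C (Suc 0) M g ` carrier (Ext C (Suc 0) M B) = carrier (Ext C (Suc 0) M D)"
      using ex u unfolding Ext1_covariant_right_exact_def right_exact_seq_def ses_def
      by (metis D One_nat_def)
    moreover have "ext_equiv C (Suc 0) M D `` {[h, p]} \<in> carrier (Ext C (Suc 0) M D)"
      using H unfolding carrier_Ext by blast
    ultimately have "ext_equiv C (Suc 0) M D `` {[h, p]} \<in>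
        ext_push C (Suc 0) M g ` carrier (Ext C (Suc 0) M B)"
      by simp
    then obtain E where E: "E \<in> n_extensions C (Suc 0) M B"
      and push: "ext_push C (Suc 0) M g (ext_equiv C (Suc 0) M B `` {E}) = ext_equiv C (Suc 0) M D `` {[h, p]}"
      unfolding carrier_Ext by (elim imageE) simp
    obtain E' where E': "E' \<in> n_extensions C (Suc 0) M D" "ext_morphism C g (idn C M) E E'"
      using ex_ext_push[OF E T(2)] .
    have "ext_morphism C (idn C D) (idn C M) E' [h, p]"
      using push ext_class_eq_1[OF E'(1) H] unfolding ext_push_class[OF E T(2) E'] by simp
    \<comment> \<open>The morphism over \<open>g\<close> to \<open>E'\<close> is continued along the
      equivalence, so that it ends in the representative \<open>[h, p]\<close> itself.\<close>
    then have "ext_morphism C (idn C D \<cdot> g) (idn C M \<cdot> idn C M) E [h, p]"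
      using ext_morphism_1_comp[OF E E'(1) H E'(2)] by blast
    then have m: "ext_morphism C g (idn C M) E [h, p]"
      using T M by (simp add: idn_left Hom_iff)
    obtain j Q q where e: "E = [j, q]" and j: "ses C B j Q q M" using E unfolding n_extensions_1 by auto
    obtain e where "e \<in> Hom C Q P" "e \<cdot> j = h \<cdot> g" "p \<cdot> e = q"
      using m sesD(2)[OF j] unfolding e ext_morphism_1[OF j h] by (auto simp: idn_left)
    then show "lifted C B (h \<cdot> g) P p M" using j unfolding lifted_def by blast
  qed
next
  assume lift: "extensions_lift C M"
  show "Ext1_covariant_right_exact C M"
    unfolding Ext1_covariant_right_exact_def right_exact_seq_def One_nat_def
  proof (intro allI impI conjI)
    fix f g assume fg: "short_exact C f g"
    define A B D where "A = Dom C f" and "B = Dom C g" and "D = Cod C g"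
    have s: "ses C A f B g D"
      using short_exact_ses[OF fg] by (simp add: A_def B_def D_def)
    note T = sesD[OF s]
    show "ext_push C (Suc 0) M f ` carrier (Ext C (Suc 0) M (Dom C f)) =
      kernel (Ext C (Suc 0) M (Dom C g)) (Ext C (Suc 0) M (Cod C g)) (ext_push C (Suc 0) M g)"
      using ext_push_kernel[OF M s] unfolding A_def B_def D_def .
    have "ext_push C (Suc 0) M g ` carrier (Ext C (Suc 0) M B) = carrier (Ext C (Suc 0) M D)"
    proof
      show "ext_push C (Suc 0) M g ` carrier (Ext C (Suc 0) M B) \<subseteq> carrier (Ext C (Suc 0) M D)"
        using ext_push_carrier[OF T(2)] by blast
      show "carrier (Ext C (Suc 0) M D) \<subseteq> ext_push C (Suc 0) M g ` carrier (Ext C (Suc 0) M B)"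
      proof
        fix x assume "x \<in> carrier (Ext C (Suc 0) M D)"
        then obtain h P p where h: "ses C D h P p M" and x: "x = ext_equiv C (Suc 0) M D `` {[h, p]}"
          unfolding carrier_Ext n_extensions_1 by (auto simp: n_extensions_1)
        obtain Q j e where j: "e \<in> Hom C Q P" "e \<cdot> j = h \<cdot> g" "ses C B j Q (p \<cdot> e) M"
          using lift s h unfolding extensions_lift_def lifted_def by blast
        have F: "[j, p \<cdot> e] \<in> n_extensions C (Suc 0) M B" "[h, p] \<in> n_extensions C (Suc 0) M D"
          using j(3) h unfolding n_extensions_1 by blast+
        have "ext_morphism C g (idn C M) [j, p \<cdot> e] [h, p]"
          unfolding ext_morphism_1[OF j(3) h] using T j M sesD[OF j(3)] by (auto simp: idn_left idn_in)
        then show "x \<in> ext_push C (Suc 0) M g ` carrier (Ext C (Suc 0) M B)"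
          using ext_push_class[OF F(1) T(2) F(2)] x F(1) unfolding carrier_Ext by blast
      qed
    qed
    then show "ext_push C (Suc 0) M g ` carrier (Ext C (Suc 0) M (Dom C g)) =
      carrier (Ext C (Suc 0) M (Cod C g))"
      unfolding B_def D_def .
  qed
qed

end

text \<open>This compares Ext over \<open>C\<close> with Ext over its opposite, \<open>T\<close>
  being the reversal of all lists in a class. Injectivity allows images and kernels to be
  compared.\<close>

lemma right_exact_seq_transport:
  assumes T: "inj T"
    and "carrier G' = T ` carrier G" "carrier H' = T ` carrier H" "carrier K' = T ` carrier K"
    and "\<one>\<^bsub>K'\<^esub> = T \<one>\<^bsub>K\<^esub>"
    and "\<And>x. x \<in> carrier G \<Longrightarrow> \<phi>' (T x) = T (\<phi> x)" "\<And>x. x \<in> carrier H \<Longrightarrow> \<psi>' (T x) = T (\<psi> x)"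
  shows "right_exact_seq G' \<phi>' H' \<psi>' K' \<longleftrightarrow> right_exact_seq G \<phi> H \<psi> K"
proof -
  have "\<phi>' ` carrier G' = T ` \<phi> ` carrier G" "\<psi>' ` carrier H' = T ` \<psi> ` carrier H"
    using assms by (auto simp: image_image)
  moreover have "kernel H' K' \<psi>' = T ` kernel H K \<psi>"
    using assms injD[OF T] unfolding kernel_def by auto
  ultimately show ?thesis
    unfolding right_exact_seq_def by (simp add: inj_image_eq_iff[OF T] assms(4))
qed

lemma in_rev_image_iff: "xs \<in> rev ` A \<longleftrightarrow> rev xs \<in> A"
  by (auto intro: image_eqI[of _ rev "rev xs"])

section \<open>Duality between pullback and pushout of classes\<close>

context abelian_category
begin

text \<open>Read in the opposite category, an extension is the reversed list with its ends
  exchanged. Hence \<open>rev\<close> translates representatives and \<open>image rev\<close>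
  translates classes.\<close>

lemma n_extensions_1_opp:
  "E \<in> n_extensions (opp C) (Suc 0) Z X \<longleftrightarrow> rev E \<in> n_extensions C (Suc 0) X Z"
  unfolding n_extensions_1 ses_opp[symmetric] rev_swap by auto

lemma ext_morphism_1_opp:
  assumes "E \<in> n_extensions C (Suc 0) X Z" "E' \<in> n_extensions C (Suc 0) X' Z'"
  shows "ext_morphism (opp C) c a (rev E') (rev E) \<longleftrightarrow> ext_morphism C a c E E'"
proof -
  obtain f B g f' B' g' where e: "E = [f, g]" "E' = [f', g']"
    and s: "ses C Z f B g X" "ses C Z' f' B' g' X'"
    using assms unfolding n_extensions_1 by auto
  have "ses (opp C) X g B f Z" "ses (opp C) X' g' B' f' Z'" using s by (simp_all add: ses_opp)
  from ext_morphism_1[OF this(2,1)] ext_morphism_1[OF s] show ?thesis by (auto simp: e)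
qed

lemma ext_equiv_1_opp:
  "(E, E') \<in> ext_equiv (opp C) (Suc 0) Z X \<longleftrightarrow> (rev E, rev E') \<in> ext_equiv C (Suc 0) X Z"
proof -
  \<comment> \<open>Reversal also turns the direction of a morphism around; the symmetry of steps in
    degree one makes up for this.\<close>
  have "(E, E') \<in> ext_step (opp C) (Suc 0) Z X \<longleftrightarrow> (rev E', rev E) \<in> ext_step C (Suc 0) X Z"
    using ext_morphism_1_opp[of "rev E'" X Z "rev E" X Z]
    unfolding ext_step_def by (auto simp: n_extensions_1_opp)
  then show ?thesis
    using ext_step_1_sym unfolding ext_equiv_1 abelian_category.ext_equiv_1[OF opp_abelian] by blast
qed

lemma ext_class_1_opp:
  "ext_equiv (opp C) (Suc 0) Z X `` {rev E} = rev ` (ext_equiv C (Suc 0) X Z `` {E})"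
  by (auto simp: ext_equiv_1_opp in_rev_image_iff)

lemma carrier_Ext_1_opp:
  "carrier (Ext (opp C) (Suc 0) Z X) = image rev ` carrier (Ext C (Suc 0) X Z)"
proof -
  have "n_extensions (opp C) (Suc 0) Z X = rev ` n_extensions C (Suc 0) X Z"
    by (auto simp: n_extensions_1_opp in_rev_image_iff)
  then show ?thesis by (simp add: carrier_Ext image_image ext_class_1_opp)
qed

text \<open>The biproducts chosen in \<open>opp C\<close> need not be those chosen in
  \<open>C\<close>, so the two zero extensions are compared up to equivalence. The reversed zero
  extension of \<open>C\<close> is split in \<open>opp C\<close> by \<open>in2 C Z X\<close>, hence
  equivalent to the zero extension there.\<close>

lemma one_Ext_1_opp:
  assumes "X \<in> Obj C" "Z \<in> Obj C"
  shows "\<one>\<^bsub>Ext (opp C) (Suc 0) Z X\<^esub> = rev ` \<one>\<^bsub>Ext C (Suc 0) X Z\<^esub>"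
proof -
  interpret O: abelian_category "opp C" by (rule opp_abelian)
  define E where "E = zero_extension C (Suc 0) X Z"
  obtain S where b: "ses C Z (in1 C Z X) S (pr2 C Z X) X" "in2 C Z X \<in> Hom C X S"
    "pr2 C Z X \<cdot> in2 C Z X = idn C X"
    using biproduct_ses[OF is_biproduct_chosen[OF assms(2,1)]] by metis
  have s: "ses (opp C) X (pr2 C Z X) S (in1 C Z X) Z" using b(1) by (simp add: ses_opp)
  have "idn C X \<in> Hom (opp C) X X" using idn_in assms by simp
  moreover have "\<exists>r\<in>Hom (opp C) S X. r \<cdot>\<^bsub>opp C\<^esub> pr2 C Z X = idn C X" using b by auto
  ultimately have "ext_morphism (opp C) (idn C X) (idn C Z) (rev E) (zero_extension (opp C) (Suc 0) Z X)"
    using O.ext_morphism_zero_iff[OF s, of "idn C X" X] by (simp add: E_def zero_extension_def)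
  moreover have "rev E \<in> n_extensions (opp C) (Suc 0) Z X"
    using zero_extension_1[OF assms] by (simp add: n_extensions_1_opp E_def)
  ultimately have "ext_equiv (opp C) (Suc 0) Z X `` {rev E} =
      ext_equiv (opp C) (Suc 0) Z X `` {zero_extension (opp C) (Suc 0) Z X}"
    using O.ext_class_eq_1 O.zero_extension_1 assms by simp
  then show ?thesis by (simp add: Ext_def ext_class_1_opp E_def)
qed

text \<open>A pullback along \<open>c\<close> is characterized by a morphism into the given
  extension, a pushout by one out of it, and reversal exchanges the two.\<close>

lemma ext_push_opp:
  assumes c: "c \<in> Hom C X' X" and \<xi>: "\<xi> \<in> carrier (Ext C (Suc 0) X Z)"
  shows "ext_push (opp C) (Suc 0) Z c (rev ` \<xi>) = rev ` ext_pull C (Suc 0) Z c \<xi>"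
proof -
  have \<xi>': "\<xi> \<subseteq> n_extensions C (Suc 0) X Z"
    using \<xi> unfolding carrier_Ext by (auto simp: ext_equiv_def)
  have D: "Dom C c = X'" using c by (simp add: Hom_iff)
  have "F \<in> ext_push (opp C) (Suc 0) Z c (rev ` \<xi>) \<longleftrightarrow> rev F \<in> ext_pull C (Suc 0) Z c \<xi>" for F
  proof -
    have "F \<in> ext_push (opp C) (Suc 0) Z c (rev ` \<xi>) \<longleftrightarrow>
      (\<exists>E'. rev E' \<in> n_extensions C (Suc 0) X' Z \<and>
         (\<exists>E\<in>\<xi>. ext_morphism (opp C) c (idn C Z) (rev E) E') \<and>
         (rev E', rev F) \<in> ext_equiv C (Suc 0) X' Z)"
      unfolding ext_push_def by (auto simp: D n_extensions_1_opp ext_equiv_1_opp)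
    also have "\<dots> \<longleftrightarrow> (\<exists>E'. E' \<in> n_extensions C (Suc 0) X' Z \<and>
         (\<exists>E\<in>\<xi>. ext_morphism (opp C) c (idn C Z) (rev E) (rev E')) \<and>
         (E', rev F) \<in> ext_equiv C (Suc 0) X' Z)"
      by (metis rev_rev_ident)
    also have "\<dots> \<longleftrightarrow> (\<exists>E'. E' \<in> n_extensions C (Suc 0) X' Z \<and>
         (\<exists>E\<in>\<xi>. ext_morphism C (idn C Z) c E' E) \<and> (E', rev F) \<in> ext_equiv C (Suc 0) X' Z)"
      using ext_morphism_1_opp[of _ X' Z _ X Z] \<xi>' by blast
    also have "\<dots> \<longleftrightarrow> rev F \<in> ext_pull C (Suc 0) Z c \<xi>"
      unfolding ext_pull_def by (auto simp: D)
    finally show ?thesis .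
  qed
  then show ?thesis unfolding set_eq_iff in_rev_image_iff by blast
qed

text \<open>In the opposite category \<open>g\<close> becomes the monic and \<open>f\<close> the
  epic, and pullbacks become pushouts; the two sequences correspond under reversal of lists.\<close>

lemma contravariant_right_exact_iff:
  assumes M: "M \<in> Obj C"
  shows "Ext1_contravariant_right_exact C M \<longleftrightarrow> Ext1_covariant_right_exact (opp C) M"
proof -
  interpret O: abelian_category "opp C" by (rule opp_abelian)
  have se: "short_exact (opp C) g f \<longleftrightarrow> short_exact C f g" for f g
  proof
    assume "short_exact C f g"
    then show "short_exact (opp C) g f" using short_exact_ses ses_opp ses_def by metis
  next
    assume "short_exact (opp C) g f"
    then show "short_exact C f g" using short_exact_ses[of "opp C" g f] ses_opp ses_def by metis
  qed
  have "right_exact_seq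
      (Ext (opp C) (Suc 0) M (Cod C g)) (ext_push (opp C) (Suc 0) M g)
      (Ext (opp C) (Suc 0) M (Cod C f)) (ext_push (opp C) (Suc 0) M f)
      (Ext (opp C) (Suc 0) M (Dom C f)) \<longleftrightarrow>
    right_exact_seq
      (Ext C (Suc 0) (Cod C g) M) (ext_pull C (Suc 0) M g)
      (Ext C (Suc 0) (Dom C g) M) (ext_pull C (Suc 0) M f)
      (Ext C (Suc 0) (Dom C f) M)" if fg: "short_exact C f g" for f g
  proof -
    note s = short_exact_ses[OF fg]
    have C: "Cod C f = Dom C g" using sesD(1)[OF s] by (simp add: Hom_iff)
    show ?thesis
      unfolding C using ext_push_opp sesD(1,2)[OF s] one_Ext_1_opp[OF ses_Obj(1)[OF s] M]
      by (intro right_exact_seq_transport[where T = "image rev"])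
        (auto simp: carrier_Ext_1_opp inj_image_eq_iff intro!: injI)
  qed
  then show ?thesis
    unfolding Ext1_contravariant_right_exact_def Ext1_covariant_right_exact_def
    by (auto simp: se)
qed

text \<open>By \<open>splice_factorization_iff\<close>, the same \<open>e \<cdot> j = h \<cdot> g\<close> serves in both categories.\<close>

lemma extensions_lift_opp:
  "(\<forall>M\<in>Obj C. extensions_lift (opp C) M) \<longleftrightarrow> (\<forall>M\<in>Obj C. extensions_lift C M)"
proof -
  have "(\<forall>M\<in>Obj C. extensions_lift (opp C) M) \<longleftrightarrow>
    (\<forall>U u B1 g D h B2 p X. ses C U u B1 g D \<longrightarrow> ses C D h B2 p X \<longrightarrow>
       lifted (opp C) B2 (h \<cdot> g) B1 u U)"
    unfolding extensions_lift_def ses_opp opp_simps using ses_Obj by blast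
  also have "\<dots> \<longleftrightarrow>
    (\<forall>U u B1 g D h B2 p X. ses C U u B1 g D \<longrightarrow> ses C D h B2 p X \<longrightarrow>
       lifted C B1 (h \<cdot> g) B2 p X)"
  proof -
    have "lifted (opp C) B2 (h \<cdot> g) B1 u U \<longleftrightarrow> lifted C B1 (h \<cdot> g) B2 p X"
      if s: "ses C U u B1 g D" "ses C D h B2 p X" for U u B1 g D h B2 p X
    proof -
      have "lifted (opp C) B2 (h \<cdot> g) B1 u U \<longleftrightarrow>
        (\<exists>E j e. j \<in> Hom C B1 E \<and> e \<cdot> j = h \<cdot> g \<and> ses C U (j \<cdot> u) E e B2)"
        unfolding lifted_def ses_opp opp_simps Hom_opp by blast
      also have "\<dots> \<longleftrightarrow>
        (\<exists>E j e. e \<in> Hom C E B2 \<and> e \<cdot> j = h \<cdot> g \<and> ses C B1 j E (p \<cdot> e) X)"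
        using splice_factorization_iff[OF s] sesD(1,2) by metis
      finally show ?thesis unfolding lifted_def .
    qed
    then show ?thesis by blast
  qed
  also have "\<dots> \<longleftrightarrow> (\<forall>M\<in>Obj C. extensions_lift C M)"
    unfolding extensions_lift_def using ses_Obj by blast
  finally show ?thesis .
qed

end

section \<open>Ext in degree two\<close>

lemma ext_morphism_2:
  assumes "u \<in> Hom C Y B1" "d \<in> Hom C B1 B2" "p \<in> Hom C B2 X"
    "u' \<in> Hom C Y' B1'" "d' \<in> Hom C B1' B2'" "p' \<in> Hom C B2' X'"
  shows "ext_morphism C a c [u, d, p] [u', d', p'] \<longleftrightarrow>
    a \<in> Hom C Y Y' \<and> c \<in> Hom C X X' \<and>
    (\<exists>b1\<in>Hom C B1 B1'. \<exists>b2\<in>Hom C B2 B2'.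
       b1 \<cdot>\<^bsub>C\<^esub> u = u' \<cdot>\<^bsub>C\<^esub> a \<and> b2 \<cdot>\<^bsub>C\<^esub> d = d' \<cdot>\<^bsub>C\<^esub> b1 \<and> p' \<cdot>\<^bsub>C\<^esub> b2 = c \<cdot>\<^bsub>C\<^esub> p)"
  (is "?L \<longleftrightarrow> ?R")
proof -
  have T: "Dom C u = Y" "Cod C u = B1" "Dom C d = B1" "Cod C d = B2" "Dom C p = B2" "Cod C p = X"
    "Dom C u' = Y'" "Cod C u' = B1'" "Dom C d' = B1'" "Cod C d' = B2'" "Dom C p' = B2'" "Cod C p' = X'"
    using assms by (auto simp: Hom_def)
  show ?thesis
  proof
    assume ?L
    then obtain hs where hs: "length hs = 4" "hd hs = a" "last hs = c"
      and c: "\<forall>i<3. hs ! i \<in> Hom C (Dom C ([u, d, p] ! i)) (Dom C ([u', d', p'] ! i)) \<and>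
         hs ! Suc i \<in> Hom C (Cod C ([u, d, p] ! i)) (Cod C ([u', d', p'] ! i)) \<and>
         ([u', d', p'] ! i) \<cdot>\<^bsub>C\<^esub> (hs ! i) = (hs ! Suc i) \<cdot>\<^bsub>C\<^esub> ([u, d, p] ! i)"
      unfolding ext_morphism_def by (auto simp: numeral_eq_Suc)
    obtain b1 b2 where "hs = [a, b1, b2, c]" using hs by (auto simp: length_Suc_conv numeral_eq_Suc)
    then show ?R using c[rule_format, of 0] c[rule_format, of 1] c[rule_format, of 2] T
      by (intro conjI bexI[of _ b1] bexI[of _ b2]) (simp_all add: numeral_2_eq_2)
  next
    assume ?R
    then obtain b1 b2 where "a \<in> Hom C Y Y'" "c \<in> Hom C X X'" "b1 \<in> Hom C B1 B1'" "b2 \<in> Hom C B2 B2'"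
      "b1 \<cdot>\<^bsub>C\<^esub> u = u' \<cdot>\<^bsub>C\<^esub> a" "b2 \<cdot>\<^bsub>C\<^esub> d = d' \<cdot>\<^bsub>C\<^esub> b1" "p' \<cdot>\<^bsub>C\<^esub> b2 = c \<cdot>\<^bsub>C\<^esub> p"
      by auto
    then show ?L unfolding ext_morphism_def
      by (intro conjI exI[of _ "[a, b1, b2, c]"]) (auto simp: T less_Suc_eq)
  qed
qed

section \<open>Two-extensions as spliced short exact sequences\<close>

context abelian_category
begin

text \<open>\<open>D\<close> is the image of \<open>d\<close>: the kernel \<open>h\<close> of
  \<open>p\<close> is also the kernel of the cokernel \<open>c\<close> of \<open>d\<close>, so
  \<open>d\<close> factors through it. The main point is that \<open>g\<close> is epic, that is,
  that \<open>d\<close> factors through no smaller subobject.\<close>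

lemma exact_at_factor:
  assumes "exact_at C d p" "epic C p" "d \<in> Hom C B1 B2" "p \<in> Hom C B2 X"
  obtains g D h where "ses C D h B2 p X" "g \<in> Hom C B1 D" "epic C g" "h \<cdot> g = d"
proof -
  obtain h c where h: "is_kernel C p h" and c: "is_cokernel C d c" and hc: "is_kernel C c h"
    using assms(1) unfolding exact_at_def is_image_def by auto
  define D W where "D = Dom C h" and "W = Cod C c"
  have h': "h \<in> Hom C D B2" using h assms(4) unfolding is_kernel_def D_def by (auto simp: Hom_iff)
  have c': "c \<in> Hom C B2 W" using c assms(3) unfolding is_cokernel_def W_def by (auto simp: Hom_iff)
  have s: "ses C D h B2 p X"
    using epic_cokernel_of_kernel[OF assms(2) h h' assms(4)] h h' assms(4) unfolding ses_iff by blast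
  obtain g where g: "g \<in> Hom C B1 D" "h \<cdot> g = d"
    using kernel_factor[OF hc h' c' assms(3) cokernel_zero[OF c assms(3) c']] by blast
  have "epic C g"
  proof (rule epicI[OF g(1)])
    fix V t assume t: "t \<in> Hom C D V" "t \<cdot> g = hzero C B1 V"
    \<comment> \<open>If \<open>t\<close> kills \<open>g\<close>, then \<open>g\<close> factors
      through the kernel \<open>l\<close> of \<open>t\<close>, so \<open>d\<close> factors through
      the subobject \<open>h \<cdot> l\<close> of \<open>B2\<close>. This subobject is shown to be
      all of \<open>D\<close>.\<close>
    obtain l where l: "is_kernel C t l" using ex_kernel t by (auto simp: Hom_iff)
    define L where "L = Dom C l"
    have l': "l \<in> Hom C L D" using l t unfolding is_kernel_def L_def by (auto simp: Hom_iff)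
    obtain g' where g': "g' \<in> Hom C B1 L" "l \<cdot> g' = g" using kernel_factor[OF l l' t(1) g(1) t(2)] by blast
    have hl: "h \<cdot> l \<in> Hom C L B2" using h' l' by (simp add: Hom_iff)
    have "monic C (h \<cdot> l)"
    proof (rule monicI[OF hl])
      fix T x assume x: "x \<in> Hom C T L" "(h \<cdot> l) \<cdot> x = hzero C T B2"
      have lx: "l \<cdot> x \<in> Hom C T D" "h \<cdot> (l \<cdot> x) = hzero C T B2" using x h' l' by (auto simp: Hom_iff)
      have "l \<cdot> x = hzero C T D" using monic_zeroD sesD[OF s] lx by blast
      then show "x = hzero C T L" using monic_zeroD[OF kernel_monic[OF l l' t(1)] l' x(1)] by blast
    qed
    then obtain q Q where q: "ses C L (h \<cdot> l) B2 q Q" using ses_of_monic hl by blast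
    note q' = sesD[OF q]
    \<comment> \<open>The cokernel \<open>q\<close> of \<open>h \<cdot> l\<close> kills
      \<open>d\<close>, so it factors through \<open>c\<close> and kills \<open>h\<close> as well.
      Hence \<open>h\<close> factors through \<open>h \<cdot> l\<close>, and \<open>l\<close> has a
      right inverse \<open>r\<close>.\<close>
    have "q \<cdot> d = (q \<cdot> (h \<cdot> l)) \<cdot> g'"
      using q'(2) h' l' g' by (auto simp: g(2)[symmetric] g'(2)[symmetric] Hom_iff)
    then have "q \<cdot> d = hzero C B1 Q" using q'(2,3) g' by (simp add: Hom_iff)
    then obtain s where s': "s \<in> Hom C W Q" "s \<cdot> c = q"
      using cokernel_factor[OF c assms(3) c' q'(2)] by blast
    have "q \<cdot> h = s \<cdot> (c \<cdot> h)" using s' c' h' by (auto simp: Hom_iff)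
    then have "q \<cdot> h = hzero C D Q" using s' h' by (simp add: kernel_zero[OF hc h' c'] Hom_iff)
    then obtain r where r: "r \<in> Hom C D L" "(h \<cdot> l) \<cdot> r = h" using ses_lift[OF q h'] by blast
    have "l \<cdot> r = idn C D"
    proof (rule monicD)
      show "h \<cdot> (l \<cdot> r) = h \<cdot> idn C D" using r h' l' by (simp add: Hom_iff)
    qed (use sesD[OF s] l' r idn_in ses_Obj[OF s] compo_in in blast)+
    then have "t = t \<cdot> (l \<cdot> r)" using t by (simp add: Hom_iff)
    also have "\<dots> = hzero C D V"
      using t(1) l' r(1) by (simp add: reassoc[OF kernel_zero[OF l l' t(1)]] Hom_iff)
    finally show "t = hzero C D V" .
  qed
  then show ?thesis using that s g by blast
qed

text \<open>The sequence is cut at the image \<open>D\<close> of its middle arrow. As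
  \<open>h\<close> is monic, \<open>g\<close> and \<open>h \<cdot> g\<close> have the same kernel;
  as \<open>g\<close> is epic, \<open>h\<close> and \<open>h \<cdot> g\<close> have the same
  cokernel; so exactness passes between the long sequence and the two short ones.\<close>

lemma n_extensions_2:
  "E \<in> n_extensions C 2 X Y \<longleftrightarrow>
    (\<exists>u B1 g D h B2 p. E = [u, h \<cdot> g, p] \<and> ses C Y u B1 g D \<and> ses C D h B2 p X)"
proof
  assume E: "E \<in> n_extensions C 2 X Y"
  then obtain u d p where e: "E = [u, d, p]"
    unfolding n_extensions_def by (auto simp: length_Suc_conv numeral_eq_Suc)
  have ud: "exact_at C u d" and dp: "exact_at C d p" and mono: "monic C u" and epi: "epic C p"
    and "Dom C u = Y" "Cod C p = X"
    using E unfolding n_extensions_def e by (auto simp: numeral_2_eq_2 less_Suc_eq)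
  then obtain B1 B2 where u: "u \<in> Hom C Y B1" and d: "d \<in> Hom C B1 B2" and p: "p \<in> Hom C B2 X"
    unfolding exact_at_def by (auto simp: Hom_def)
  obtain g D h where h: "ses C D h B2 p X" and g: "g \<in> Hom C B1 D" "epic C g" "h \<cdot> g = d"
    using exact_at_factor[OF dp epi d p] .
  obtain k c where k: "is_kernel C d k" and c: "is_cokernel C u c" and kc: "is_kernel C c k"
    using ud unfolding exact_at_def is_image_def by auto
  define K W where "K = Dom C k" and "W = Cod C c"
  have k': "k \<in> Hom C K B1" using k d unfolding is_kernel_def K_def by (auto simp: Hom_iff)
  have c': "c \<in> Hom C B1 W" using c u unfolding is_cokernel_def W_def by (auto simp: Hom_iff)
  have uc: "is_kernel C c u" by (rule monic_kernel_of_cokernel[OF mono c u c'])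
  have "ses C Y u B1 g D"
  proof (rule sesI_kernel[OF u g(1) _ mono g(2)])
    obtain s where s: "s \<in> Hom C Y K" "k \<cdot> s = u"
      using kernel_factor[OF kc k' c' u kernel_zero[OF uc u c']] by blast
    have "h \<cdot> (g \<cdot> u) = d \<cdot> u" using u g(1) sesD(1)[OF h] by (simp add: reassoc[OF g(3)] Hom_iff)
    also have "\<dots> = (d \<cdot> k) \<cdot> s" using s k' d by (auto simp: Hom_iff)
    also have "\<dots> = hzero C Y B2" using s(1) d by (simp add: kernel_zero[OF k k' d] Hom_iff)
    finally show "g \<cdot> u = hzero C Y D" using monic_zeroD[OF sesD(4,1)[OF h] compo_in[OF u g(1)]] by blast
    fix V x assume x: "x \<in> Hom C V B1" "g \<cdot> x = hzero C V D"
    \<comment> \<open>What \<open>d\<close> kills factors through \<open>k\<close>, is therefore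
      killed by \<open>c\<close>, and so factors through the kernel \<open>u\<close> of
      \<open>c\<close>.\<close>
    have "d \<cdot> x = h \<cdot> (g \<cdot> x)" using x(1) g(1) sesD(1)[OF h] by (simp add: reassoc[OF g(3)] Hom_iff)
    then have "d \<cdot> x = hzero C V B2" using x sesD(1)[OF h] by (simp add: Hom_iff)
    then obtain y where y: "y \<in> Hom C V K" "k \<cdot> y = x" using kernel_factor[OF k k' d x(1)] by blast
    have "c \<cdot> x = (c \<cdot> k) \<cdot> y" using y k' c' by (auto simp: Hom_iff)
    then have "c \<cdot> x = hzero C V W" using y(1) c' by (simp add: kernel_zero[OF kc k' c'] Hom_iff)
    then show "\<exists>z\<in>Hom C V Y. u \<cdot> z = x" using kernel_factor[OF uc u c' x(1)] by blast
  qed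
  then show "\<exists>u B1 g D h B2 p. E = [u, h \<cdot> g, p] \<and> ses C Y u B1 g D \<and> ses C D h B2 p X"
    using h g(3) e by blast
next
  assume "\<exists>u B1 g D h B2 p. E = [u, h \<cdot> g, p] \<and> ses C Y u B1 g D \<and> ses C D h B2 p X"
  then obtain u B1 g D h B2 p where e: "E = [u, h \<cdot> g, p]" and ug: "ses C Y u B1 g D" and hp: "ses C D h B2 p X"
    by blast
  note T = sesD[OF ug] sesD[OF hp] ses_Obj[OF ug] ses_Obj[OF hp]
  have d: "h \<cdot> g \<in> Hom C B1 B2" using T by (simp add: Hom_iff)
  have "is_kernel C (h \<cdot> g) u"
  proof (rule kernelI[OF T(1) d _ T(4)])
    show "(h \<cdot> g) \<cdot> u = hzero C Y B2" using T by (simp add: Hom_iff)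
    fix W x assume x: "x \<in> Hom C W B1" "(h \<cdot> g) \<cdot> x = hzero C W B2"
    have "g \<cdot> x \<in> Hom C W D" "h \<cdot> (g \<cdot> x) = hzero C W B2" using x T by (auto simp: Hom_iff)
    then have "g \<cdot> x = hzero C W D" using monic_zeroD T by blast
    then show "\<exists>z\<in>Hom C W Y. u \<cdot> z = x" using ses_lift[OF ug x(1)] by blast
  qed
  moreover have "is_cokernel C (h \<cdot> g) p"
  proof (rule cokernelI[OF d T(7) _ T(10)])
    show "p \<cdot> (h \<cdot> g) = hzero C B1 X" using T by (simp add: reassoc[OF T(8)] Hom_iff)
    fix W x assume x: "x \<in> Hom C B2 W" "x \<cdot> (h \<cdot> g) = hzero C B1 W"
    have "x \<cdot> h \<in> Hom C D W" "(x \<cdot> h) \<cdot> g = hzero C B1 W" using x T by (auto simp: Hom_iff)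
    then have "x \<cdot> h = hzero C D W" using epic_zeroD T by blast
    then show "\<exists>z\<in>Hom C X W. z \<cdot> p = x" using ses_colift[OF hp x(1)] by blast
  qed
  ultimately have "exact_at C u (h \<cdot> g)" "exact_at C (h \<cdot> g) p"
    using ug hp d T unfolding exact_at_def is_image_def ses_iff by (auto simp: Hom_iff)
  then show "E \<in> n_extensions C 2 X Y"
    using T d unfolding e n_extensions_def by (auto simp: numeral_2_eq_2 less_Suc_eq Hom_iff)
qed

section \<open>The zero class in degree two and the transport of liftings\<close>

lemma ses_zero_object:
  assumes N: "is_zero_object C N" and X: "X \<in> Obj C"
  shows "ses C X (idn C X) X (hzero C X N) N"
proof -
  have NO: "N \<in> Obj C" using N by (simp add: is_zero_object_def)
  have 0: "hzero C X N \<in> Hom C X N" using X NO by (simp add: Hom_iff)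
  show ?thesis
  proof (rule sesI_kernel[OF idn_in[OF X] 0])
    show "hzero C X N \<cdot> idn C X = hzero C X N" using X NO by simp
    show "monic C (idn C X)"
      by (rule monicI[OF idn_in[OF X]]) (simp add: idn_left)
    show "epic C (hzero C X N)"
    proof (rule epicI[OF 0])
      fix W u assume u: "u \<in> Hom C N W"
      then have "W \<in> Obj C" "hzero C N W \<in> Hom C N W" using NO by (auto simp: Hom_iff)
      then show "u = hzero C N W" using u N unfolding is_zero_object_def by blast
    qed
    show "\<exists>u\<in>Hom C W X. idn C X \<cdot> u = h" if "h \<in> Hom C W X" for W h
      using that idn_left by blast
  qed
qed

lemma zero_extension_2:
  assumes "X \<in> Obj C" "Y \<in> Obj C"
  shows "zero_extension C 2 X Y = [idn C Y, hzero C Y X, idn C X]"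
    and "zero_extension C 2 X Y \<in> n_extensions C 2 X Y"
proof -
  \<comment> \<open>For \<open>n = 2\<close> the list \<open>replicate (n - 2) (zobj C)\<close> is
    empty, so a single zero arrow joins \<open>Y\<close> to \<open>X\<close> directly.\<close>
  show e: "zero_extension C 2 X Y = [idn C Y, hzero C Y X, idn C X]"
    by (simp add: zero_extension_def)
  obtain N where N: "is_zero_object C N" using ex_zero_object by auto
  have "ses (opp C) X (idn C X) X (hzero C N X) N"
    using abelian_category.ses_zero_object[OF opp_abelian, of N X] N assms by simp
  then have "ses C N (hzero C N X) X (idn C X) X" by (simp add: ses_opp)
  \<comment> \<open>The zero arrow is cut at a zero object \<open>N\<close>, which is its
    image.\<close>
  moreover have "hzero C Y X = hzero C N X \<cdot> hzero C Y N"
    using assms N by (simp add: is_zero_object_def)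
  ultimately show "zero_extension C 2 X Y \<in> n_extensions C 2 X Y"
    unfolding n_extensions_2 e using ses_zero_object[OF N assms(2)] by metis
qed

text \<open>A lifting is pushed out along a morphism of \<open>2\<close>-extensions. In the opposite direction, it is
  pulled back, as an extension of \<open>B2\<close> by \<open>Y\<close>.\<close>

lemma lifted_ext_step:
  assumes E: "[u, d, p] \<in> n_extensions C 2 X Y" "[u', d', p'] \<in> n_extensions C 2 X Y"
    and T: "d \<in> Hom C B1 B2" "d' \<in> Hom C B1' B2'"
    and m: "ext_morphism C (idn C Y) (idn C X) [u, d, p] [u', d', p']"
  shows "lifted C B1 d B2 p X \<longleftrightarrow> lifted C B1' d' B2' p' X"
proof -
  obtain g D h where d: "d = h \<cdot> g" and s: "ses C Y u B1 g D" "ses C D h B2 p X"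
    using E(1) T(1) unfolding n_extensions_2 by (auto simp: ses_def Hom_def)
  obtain g' D' h' where d': "d' = h' \<cdot> g'" and s': "ses C Y u' B1' g' D'" "ses C D' h' B2' p' X"
    using E(2) T(2) unfolding n_extensions_2 by (auto simp: ses_def Hom_def)
  note T = T sesD(1,2)[OF s(1)] sesD(1,2)[OF s(2)] sesD(1,2)[OF s'(1)] sesD(1,2)[OF s'(2)]
    ses_Obj[OF s(1)] ses_Obj[OF s(2)]
  obtain b1 b2 where b: "b1 \<in> Hom C B1 B1'" "b2 \<in> Hom C B2 B2'"
    and e: "b1 \<cdot> u = u'" "b2 \<cdot> d = d' \<cdot> b1" "p' \<cdot> b2 = p"
    using m unfolding ext_morphism_2[OF T(3,1,6,7,2,10)] using T(6,7) by (auto simp: idn_left idn_right)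
  show ?thesis
  proof
    assume "lifted C B1 d B2 p X"
    then obtain P j e where j: "e \<in> Hom C P B2" "e \<cdot> j = d" "ses C B1 j P (p \<cdot> e) X"
      unfolding lifted_def by blast
    note j' = sesD[OF j(3)]
    \<comment> \<open>The lifting is pushed out along \<open>b1\<close>; the universal property then
      produces its arrow \<open>w\<close> to \<open>B2'\<close> from \<open>b2 \<cdot> e\<close> and
      \<open>d'\<close>.\<close>
    obtain P' j' n q where j': "ses C B1' j' P' q X" "n \<in> Hom C P P'" "n \<cdot> j = j' \<cdot> b1" "q \<cdot> n = p \<cdot> e"
      and univ: "\<And>T x y. x \<in> Hom C P T \<Longrightarrow> y \<in> Hom C B1' T \<Longrightarrow> x \<cdot> j = y \<cdot> b1 \<Longrightarrow>
       \<exists>w\<in>Hom C P' T. w \<cdot> n = x \<and> w \<cdot> j' = y"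
      and uniq: "\<And>T v w. v \<in> Hom C P' T \<Longrightarrow> w \<in> Hom C P' T \<Longrightarrow> v \<cdot> n = w \<cdot> n \<Longrightarrow> v \<cdot> j' = w \<cdot> j' \<Longrightarrow> v = w"
      by (rule ex_pushout[OF j(3) b(1)]) blast
    have "(b2 \<cdot> e) \<cdot> j = d' \<cdot> b1"
      using b j(1) sesD(1)[OF j(3)] by (simp add: j(2) \<open>b2 \<cdot> d = d' \<cdot> b1\<close> Hom_iff)
    then obtain w where w: "w \<in> Hom C P' B2'" "w \<cdot> n = b2 \<cdot> e" "w \<cdot> j' = d'"
      using univ[OF compo_in[OF j(1) b(2)] T(2)] by blast
    have "p' \<cdot> w = q"
    proof (rule uniq)
      show "(p' \<cdot> w) \<cdot> n = q \<cdot> n"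
        using w(1) j'(2) T b j(1) by (simp add: w(2) j'(4) reassoc[OF \<open>p' \<cdot> b2 = p\<close>] Hom_iff)
      have "(p' \<cdot> w) \<cdot> j' = (p' \<cdot> h') \<cdot> g'"
        using w(1) sesD(1)[OF j'(1)] T(7-10) by (simp add: w(3) d' Hom_iff)
      then show "(p' \<cdot> w) \<cdot> j' = q \<cdot> j'"
        using T(8,9,10) by (simp add: sesD(3)[OF s'(2)] sesD(3)[OF j'(1)] Hom_iff)
    qed (use w(1) T(10) sesD(2)[OF j'(1)] compo_in in blast)+
    then show "lifted C B1' d' B2' p' X" using w j'(1) unfolding lifted_def by blast
  next
    assume "lifted C B1' d' B2' p' X"
    then obtain P' j' e' where j': "e' \<in> Hom C P' B2'" "e' \<cdot> j' = d'" "ses C B1' j' P' (p' \<cdot> e') X"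
      unfolding lifted_def by blast
    have j'': "j' \<in> Hom C B1' P'" using sesD(1)[OF j'(3)] .
    have "ses C Y (j' \<cdot> u') P' e' B2'"
      using splice_factorization[OF s' j'' j'(1) _ j'(3)] j'(2) d' by simp
    then obtain P v n e0 where v: "ses C Y v P e0 B2" "n \<in> Hom C P P'" "e' \<cdot> n = b2 \<cdot> e0" "n \<cdot> v = j' \<cdot> u'"
      and univ: "\<And>T x y. x \<in> Hom C T P' \<Longrightarrow> y \<in> Hom C T B2 \<Longrightarrow> e' \<cdot> x = b2 \<cdot> y \<Longrightarrow>
       \<exists>w\<in>Hom C T P. n \<cdot> w = x \<and> e0 \<cdot> w = y"
      and uniq: "\<And>T v w. v \<in> Hom C T P \<Longrightarrow> w \<in> Hom C T P \<Longrightarrow> n \<cdot> v = n \<cdot> w \<Longrightarrow> e0 \<cdot> v = e0 \<cdot> w \<Longrightarrow> v = w"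
      by (rule ex_pullback[OF _ b(2)]) blast
    have "e' \<cdot> (j' \<cdot> b1) = b2 \<cdot> d"
      using b j'(1) j'' by (simp add: reassoc[OF j'(2)] \<open>b2 \<cdot> d = d' \<cdot> b1\<close> Hom_iff)
    then obtain j where j: "j \<in> Hom C B1 P" "n \<cdot> j = j' \<cdot> b1" "e0 \<cdot> j = d"
      using univ[OF compo_in[OF b(1) j''] T(1)] by blast
    \<comment> \<open>The kernel arrow \<open>v\<close> of the pullback must have the shape
      \<open>j \<cdot> u\<close> before \<open>splice_factorization_iff\<close> can turn the
      extension of \<open>B2\<close> by \<open>Y\<close> back into one of \<open>X\<close> by
      \<open>B1\<close>.\<close>
    have "j \<cdot> u = v"
    proof (rule uniq)
      show "n \<cdot> (j \<cdot> u) = n \<cdot> v"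
        using j(1) v(2) T b j'' by (simp add: reassoc[OF j(2)] v(4) e(1) Hom_iff)
      have "e0 \<cdot> (j \<cdot> u) = h \<cdot> (g \<cdot> u)"
        using j(1) sesD(2)[OF v(1)] T by (simp add: reassoc[OF j(3)] d Hom_iff)
      then show "e0 \<cdot> (j \<cdot> u) = e0 \<cdot> v"
        using T by (simp add: sesD(3)[OF s(1)] sesD(3)[OF v(1)] Hom_iff)
    qed (use j(1) T(3) sesD(1)[OF v(1)] compo_in in blast)+
    then have "ses C B1 j P (p \<cdot> e0) X"
      using splice_factorization_iff[OF s j(1) sesD(2)[OF v(1)]] j(3) v(1) d by simp
    then show "lifted C B1 d B2 p X" using j(3) sesD(2)[OF v(1)] unfolding lifted_def by blast
  qed
qed

text \<open>The objects are read off from the arrows, which makes the condition a predicate of the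
  list alone; it can then be followed along a zigzag of morphisms in either direction.\<close>

lemma lifted_ext_equiv:
  assumes "(E, E') \<in> ext_equiv C 2 X Y"
  shows "lifted C (Dom C (E ! 1)) (E ! 1) (Cod C (E ! 1)) (E ! 2) X \<longleftrightarrow>
    lifted C (Dom C (E' ! 1)) (E' ! 1) (Cod C (E' ! 1)) (E' ! 2) X"
proof -
  define Q where "Q F \<longleftrightarrow> lifted C (Dom C (F ! 1)) (F ! 1) (Cod C (F ! 1)) (F ! 2) X" for F
  have step: "Q F \<longleftrightarrow> Q F'" if "(F, F') \<in> ext_step C 2 X Y" for F F'
  proof -
    have F: "F \<in> n_extensions C 2 X Y" "F' \<in> n_extensions C 2 X Y"
      and m: "ext_morphism C (idn C Y) (idn C X) F F'"
      using that by (auto simp: ext_step_def)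
    then obtain u d p u' d' p' where e: "F = [u, d, p]" "F' = [u', d', p']"
      unfolding n_extensions_2 by metis
    have "d \<in> Arr C" "d' \<in> Arr C" using F unfolding e n_extensions_def by auto
    then show ?thesis
      using lifted_ext_step[of u d p X Y u' d' p' "Dom C d" "Cod C d" "Dom C d'" "Cod C d'"] F m
      unfolding Q_def e by (simp add: Hom_iff)
  qed
  have "(E, E') \<in> (ext_step C 2 X Y \<union> (ext_step C 2 X Y)\<inverse>)\<^sup>*"
    using assms by (simp add: ext_equiv_def)
  then have "Q E \<longleftrightarrow> Q E'" by (induction rule: rtrancl_induct) (use step in auto)
  then show ?thesis by (simp add: Q_def)
qed

text \<open>The lifting is the biproduct of \<open>Y\<close> and \<open>X\<close>, with the
  injection of \<open>Y\<close> and the projection to \<open>X\<close>, whose composite is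
  zero.\<close>

lemma lifted_hzero:
  assumes "X \<in> Obj C" "Y \<in> Obj C"
  shows "lifted C Y (hzero C Y X) X (idn C X) X"
proof -
  obtain S where b: "ses C Y (in1 C Y X) S (pr2 C Y X) X"
    using biproduct_ses[OF is_biproduct_chosen[OF assms(2,1)]] by metis
  then show ?thesis unfolding lifted_def using sesD[OF b] idn_left by metis
qed

text \<open>A lifting \<open>e : E \<rightarrow> B2\<close> of \<open>d\<close> along \<open>j : B1 \<rightarrow> E\<close> connects the given \<open>2\<close>-extension to the zero
  extension through \<open>0 \<rightarrow> Y \<rightarrow> Y \<oplus> B1 \<rightarrow> E \<rightarrow> X \<rightarrow> 0\<close>.\<close>

lemma lifted_ext_equiv_zero:
  assumes u: "ses C Y u B1 g D" and h: "ses C D h B2 p X" and l: "lifted C B1 (h \<cdot> g) B2 p X"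
  shows "([u, h \<cdot> g, p], zero_extension C 2 X Y) \<in> ext_equiv C 2 X Y"
proof -
  obtain E j e where j: "e \<in> Hom C E B2" "e \<cdot> j = h \<cdot> g" "ses C B1 j E (p \<cdot> e) X"
    using l unfolding lifted_def by blast
  note T = sesD(1,2)[OF u] sesD(1,2)[OF h] sesD(1,2)[OF j(3)] j(1)
    ses_Obj[OF u] ses_Obj[OF h] ses_Obj[OF j(3)]
  obtain i1 i2 p1 p2 where bp: "is_biproduct C Y B1 i1 i2 p1 p2" using ex_biproduct T by metis
  obtain S where b: "ses C Y i1 S p2 B1" "p1 \<in> Hom C S Y" "p1 \<cdot> i1 = idn C Y"
    using biproduct_ses[OF bp] by metis
  note b' = sesD(1,2)[OF b(1)] ses_Obj[OF b(1)]
  let ?F = "[i1, j \<cdot> p2, p \<cdot> e]"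
  have F: "?F \<in> n_extensions C 2 X Y" using b(1) j(3) unfolding n_extensions_2 by blast
  have E: "[u, h \<cdot> g, p] \<in> n_extensions C 2 X Y" using u h unfolding n_extensions_2 by blast
  have Z: "zero_extension C 2 X Y \<in> n_extensions C 2 X Y" using zero_extension_2 T by blast
  have d: "h \<cdot> g \<in> Hom C B1 B2" "j \<cdot> p2 \<in> Hom C S E" "hzero C Y X \<in> Hom C Y X"
    using T b' by (auto simp: Hom_iff)
  \<comment> \<open>The inner components are \<open>u \<cdot> p1 \<boxplus> p2\<close> on the
    biproduct and \<open>e\<close> on \<open>E\<close>. The summand \<open>u \<cdot> p1\<close>
    adjusts the component on \<open>Y\<close> to the identity and disappears after
    \<open>g\<close>.\<close>
  have "ext_morphism C (idn C Y) (idn C X) ?F [u, h \<cdot> g, p]"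
    unfolding ext_morphism_2[OF b'(1) d(2) T(6,1) d(1) T(4)]
  proof (intro conjI bexI)
    show "u \<cdot> p1 \<boxplus> p2 \<in> Hom C S B1" using T b' b(2) by (simp add: Hom_iff)
    show "(u \<cdot> p1 \<boxplus> p2) \<cdot> i1 = u \<cdot> idn C Y"
      using T b' b(2) by (simp add: b(3) sesD(3)[OF b(1)] Hom_iff)
    show "e \<cdot> (j \<cdot> p2) = h \<cdot> g \<cdot> (u \<cdot> p1 \<boxplus> p2)"
      using T b' b(2) by (simp add: reassoc[OF j(2)] reassoc[OF sesD(3)[OF u]] Hom_iff)
    show "p \<cdot> e = idn C X \<cdot> (p \<cdot> e)" using T by (simp add: Hom_iff)
  qed (use T idn_in in auto)
  \<comment> \<open>Here the inner components are \<open>p1\<close> and \<open>p \<cdot> e\<close>;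
    the middle square commutes because \<open>p \<cdot> e\<close> kills \<open>j\<close>.\<close>
  moreover have "ext_morphism C (idn C Y) (idn C X) ?F (zero_extension C 2 X Y)"
    unfolding zero_extension_2(1)[OF T(13,8)]
      ext_morphism_2[OF b'(1) d(2) T(6) idn_in[OF T(8)] d(3) idn_in[OF T(13)]]
  proof (intro conjI bexI)
    show "p1 \<cdot> i1 = idn C Y \<cdot> idn C Y" using T by (simp add: b(3))
    have "(p \<cdot> e) \<cdot> (j \<cdot> p2) = ((p \<cdot> e) \<cdot> j) \<cdot> p2" using T b' by (simp add: Hom_iff)
    then show "(p \<cdot> e) \<cdot> (j \<cdot> p2) = hzero C Y X \<cdot> p1"
      unfolding sesD(3)[OF j(3)] using T b' b(2) by (simp add: Hom_iff)
    show "idn C X \<cdot> (p \<cdot> e) = idn C X \<cdot> (p \<cdot> e)" ..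
  qed (use T b idn_in in auto)
  ultimately have "(?F, [u, h \<cdot> g, p]) \<in> ext_step C 2 X Y" "(?F, zero_extension C 2 X Y) \<in> ext_step C 2 X Y"
    using E F Z by (auto simp: ext_step_def)
  then have "([u, h \<cdot> g, p], ?F) \<in> (ext_step C 2 X Y \<union> (ext_step C 2 X Y)\<inverse>)\<^sup>*"
    "(?F, zero_extension C 2 X Y) \<in> (ext_step C 2 X Y \<union> (ext_step C 2 X Y)\<inverse>)\<^sup>*" by auto
  then show ?thesis using E Z unfolding ext_equiv_def by (auto intro: rtrancl_trans)
qed

text \<open>If Ext2 vanishes, every \<open>2\<close>-extension is equivalent to the zero extension,
  which has a lifting, and liftings survive equivalence. Conversely, a lifting connects each
  \<open>2\<close>-extension to the zero extension, so there is a single class.\<close>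

lemma hereditary_iff: "hereditary C \<longleftrightarrow> (\<forall>M\<in>Obj C. extensions_lift C M)"
proof
  assume her: "hereditary C"
  show "\<forall>M\<in>Obj C. extensions_lift C M"
    unfolding extensions_lift_def
  proof (intro ballI allI impI)
    fix X U u B1 g D h B2 p
    assume s: "ses C U u B1 g D" "ses C D h B2 p X"
    have E: "[u, h \<cdot> g, p] \<in> n_extensions C 2 X U" using s unfolding n_extensions_2 by blast
    have O: "X \<in> Obj C" "U \<in> Obj C" using ses_Obj s by blast+
    have "ext_equiv C 2 X U `` {[u, h \<cdot> g, p]} = ext_equiv C 2 X U `` {zero_extension C 2 X U}"
    proof -
      have "ext_equiv C 2 X U `` {[u, h \<cdot> g, p]} \<in> carrier (Ext C 2 X U)"
        using E unfolding carrier_Ext by blast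
      also have "carrier (Ext C 2 X U) = {\<one>\<^bsub>Ext C 2 X U\<^esub>}"
        using her O by (simp add: hereditary_def)
      finally show ?thesis by (simp add: Ext_def)
    qed
    then have "([u, h \<cdot> g, p], zero_extension C 2 X U) \<in> ext_equiv C 2 X U"
      using eq_equiv_class_iff[OF equiv_ext_equiv E zero_extension_2(2)[OF O]] by simp
    then have "lifted C (Dom C (h \<cdot> g)) (h \<cdot> g) (Cod C (h \<cdot> g)) p X \<longleftrightarrow>
        lifted C U (hzero C U X) X (idn C X) X"
      using lifted_ext_equiv[of "[u, h \<cdot> g, p]" "zero_extension C 2 X U" X U] O
      unfolding zero_extension_2(1)[OF O] by (simp add: nth_Cons')
    then show "lifted C B1 (h \<cdot> g) B2 p X"
      using lifted_hzero[OF O] sesD(1,2)[OF s(1)] sesD(1,2)[OF s(2)] by (simp add: Hom_iff)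
  qed
next
  assume lift: "\<forall>M\<in>Obj C. extensions_lift C M"
  show "hereditary C"
    unfolding hereditary_def
  proof (intro ballI)
    fix X Y assume O: "X \<in> Obj C" "Y \<in> Obj C"
    have "ext_equiv C 2 X Y `` {E} = ext_equiv C 2 X Y `` {zero_extension C 2 X Y}"
      if E: "E \<in> n_extensions C 2 X Y" for E
    proof -
      obtain u B1 g D h B2 p where e: "E = [u, h \<cdot> g, p]" and s: "ses C Y u B1 g D" "ses C D h B2 p X"
        using E unfolding n_extensions_2 by blast
      have "lifted C B1 (h \<cdot> g) B2 p X" using lift s O unfolding extensions_lift_def by blast
      then have "(E, zero_extension C 2 X Y) \<in> ext_equiv C 2 X Y"
        using lifted_ext_equiv_zero[OF s] e by simp
      then show ?thesis using equiv_class_eq[OF equiv_ext_equiv] by metis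
    qed
    moreover have "\<one>\<^bsub>Ext C 2 X Y\<^esub> = ext_equiv C 2 X Y `` {zero_extension C 2 X Y}"
      by (simp add: Ext_def)
    ultimately show "carrier (Ext C 2 X Y) = {\<one>\<^bsub>Ext C 2 X Y\<^esub>}"
      using zero_extension_2(2)[OF O] unfolding carrier_Ext by blast
  qed
qed

end

theorem corollary2p3:
  fixes C :: "('o, 'a) precat"
  assumes "abelian_category C"
  shows "((\<forall>M\<in>Obj C. Ext1_contravariant_right_exact C M) \<longleftrightarrow>
          (\<forall>M\<in>Obj C. Ext1_covariant_right_exact C M)) \<and>
         ((\<forall>M\<in>Obj C. Ext1_covariant_right_exact C M) \<longleftrightarrow> hereditary C)"
proof -
  interpret abelian_category C by fact
  interpret O: abelian_category "opp C" by (rule opp_abelian)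
  \<comment> \<open>Contravariant right exactness over \<open>C\<close> is covariant right exactness
    over \<open>opp C\<close>; the self-duality of the lifting condition then leads back to
    \<open>C\<close>.\<close>
  have "(\<forall>M\<in>Obj C. Ext1_contravariant_right_exact C M) \<longleftrightarrow> (\<forall>M\<in>Obj C. extensions_lift (opp C) M)"
    using contravariant_right_exact_iff O.covariant_right_exact_iff by auto
  then show ?thesis
    using covariant_right_exact_iff extensions_lift_opp hereditary_iff by auto
qed

end
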